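(* Let $0<q,r\le\infty$, $0<\alpha<\infty$ and $\beta\in\mathbb{R}$. Then, for $f\in\mathrm T^{\infty,q,r}_\beta$, $$\|f\|_{\mathrm T^{\infty,q,r}_\beta}\simeq\sup_{\tau>0}\sup_{y\in\mathbb{R}^d}\bigg(⨍_{B(y,\tau)}\bigg(\int_0^\tau\bigg(⨍_{t/2}^t⨍_{B(x,t)}|s^{-\beta}f(s,z)|^r\,\mathrm{d}z\,\mathrm{d}s\bigg)^{\frac qr}\frac{\mathrm{d}t}{t}\bigg)^{\frac\alpha q}\mathrm{d}x\bigg)^{\frac1\alpha}$$ with implicit constants depending only on $d,q,r,\alpha,\beta$.
   Context: The symbol ⨍ denotes the mean-value integral and $B(x,t)$ the open ball in $\mathbb{R}^d$. $\mathrm T^{\infty,q,r}_\beta$ is the set of all measurable functions $f$ on $\mathbb{R}^{d+1}_+=(0,\infty)\times\mathbb{R}^d$ with finite (quasi-)norm $$\|f\|_{\mathrm T^{\infty,q,r}_\beta}=\sup_{\tau>0}\sup_{y\in\mathbb{R}^d}\bigg(\int_0^\tau⨍_{B(y,\tau)}\bigg(⨍_{t/2}^t⨍_{B(x,t)}|s^{-\beta}f(s,z)|^r\,\mathrm{d}z\,\mathrm{d}s\bigg)^{q/r}\frac{\mathrm{d}x\,\mathrm{d}t}{t}\bigg)^{1/q}\quad(q<\infty),$$ $$\|f\|_{\mathrm T^{\infty,\infty,r}_\beta}=\sup_{t>0}\sup_{x\in\mathbb{R}^d}\bigg(⨍_{t/2}^t⨍_{B(x,t)}|s^{-\beta}f(s,z)|^r\,\mathrm{d}z\,\mathrm{d}s\bigg)^{1/r}.$$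 Throughout, for infinite $q$ or $r$ the corresponding integral expression is replaced by an essential supremum: for $r=\infty$ over $(s,z)\in(\frac t2,t]\times B(x,t)$; for $q=\infty$ (in the claim) over $t\in(0,\tau)$. *)

theory Defs
  imports "HOL-Analysis.Analysis" "HOL-Probability.Essential_Supremum"
begin

text \<open>All integrals are Lebesgue integrals of \<open>[0, \<infinity>]\<close>-valued functions. The power is only used
  with exponents \<open>a > 0\<close>, where \<open>0\<^sup>a = 0\<close> and \<open>\<infinity>\<^sup>a = \<infinity>\<close>.\<close>

definition ennpowr :: "ennreal \<Rightarrow> real \<Rightarrow> ennreal" where
  "ennpowr x a = (if x = \<infinity> then \<infinity> else ennreal (enn2real x powr a))"

definition mean_integral :: "'a::euclidean_space set \<Rightarrow> ('a \<Rightarrow> ennreal) \<Rightarrow> ennreal" where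
  "mean_integral A g = (\<integral>\<^sup>+ x\<in>A. g x \<partial>lebesgue) / emeasure lebesgue A"

text \<open>Points of the upper half-space \<open>(0, \<infinity>) \<times> \<real>\<^sup>d\<close> are pairs \<open>(s, z)\<close> of type \<open>real \<times> real ^ 'n\<close>
  with \<open>s > 0\<close>, where \<open>d\<close> is the cardinality of \<open>'n\<close>. Values of functions outside the half-space
  play no role.\<close>

definition weighted_abs :: "real \<Rightarrow> (real \<times> (real ^ 'n::finite) \<Rightarrow> complex) \<Rightarrow> real \<Rightarrow> real ^ 'n \<Rightarrow> real" where
  "weighted_abs \<beta> f s z = norm ((s powr (- \<beta>)) *\<^sub>R f (s, z))"

text \<open>The exponents \<open>q\<close> and \<open>r\<close> range over \<open>(0, \<infinity>]\<close>. The local average below already carries the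
  power \<open>1 / r\<close>, so that its \<open>q\<close>-th power is the \<open>q / r\<close>-th power of the mean integral.\<close>

definition whitney_avg ::
  "real \<Rightarrow> ennreal \<Rightarrow> (real \<times> (real ^ 'n::finite) \<Rightarrow> complex) \<Rightarrow> real \<Rightarrow> real ^ 'n \<Rightarrow> ennreal" where
  "whitney_avg \<beta> r f t x =
    (if r = \<infinity> then
       esssup (lebesgue_on ({t / 2<..t} \<times> ball x t)) (\<lambda>(s, z). ennreal (weighted_abs \<beta> f s z))
     else
       ennpowr
         (mean_integral {t / 2<..t} (\<lambda>s.
            mean_integral (ball x t) (\<lambda>z. ennreal (weighted_abs \<beta> f s z powr enn2real r))))
         (1 / enn2real r))"

definition tent_norm ::
  "ennreal \<Rightarrow> ennreal \<Rightarrow> real \<Rightarrow> (real \<times> (real ^ 'n::finite) \<Rightarrow> complex) \<Rightarrow> ennreal" where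
  "tent_norm q r \<beta> f =
    (if q = \<infinity> then
       (SUP t\<in>{0<..}. SUP x. whitney_avg \<beta> r f t x)
     else
       (SUP \<tau>\<in>{0<..}. SUP y.
          ennpowr
            (\<integral>\<^sup>+ t\<in>{0<..<\<tau>}.
               (mean_integral (ball y \<tau>) (\<lambda>x. ennpowr (whitney_avg \<beta> r f t x) (enn2real q)) / ennreal t)
             \<partial>lebesgue)
            (1 / enn2real q)))"

definition tent_space ::
  "ennreal \<Rightarrow> ennreal \<Rightarrow> real \<Rightarrow> (real \<times> (real ^ 'n::finite) \<Rightarrow> complex) set" where
  "tent_space q r \<beta> =
    {f. f \<in> borel_measurable (lebesgue_on ({0<..} \<times> UNIV)) \<and> tent_norm q r \<beta> f < \<infinity>}"

text \<open>Unlike in \<open>tent_norm\<close>, the integral (or essential supremum) in \<open>t\<close> is now inside the average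
  over \<open>B(y, \<tau>)\<close>.\<close>

definition vertical_norm ::
  "ennreal \<Rightarrow> ennreal \<Rightarrow> real \<Rightarrow> real \<Rightarrow> (real \<times> (real ^ 'n::finite) \<Rightarrow> complex) \<Rightarrow> ennreal" where
  "vertical_norm q r \<alpha> \<beta> f =
    (SUP \<tau>\<in>{0<..}. SUP y.
       ennpowr
         (mean_integral (ball y \<tau>) (\<lambda>x.
            if q = \<infinity> then
              ennpowr (esssup (lebesgue_on {0<..<\<tau>}) (\<lambda>t. whitney_avg \<beta> r f t x)) \<alpha>
            else
              ennpowr
                (\<integral>\<^sup>+ t\<in>{0<..<\<tau>}. (ennpowr (whitney_avg \<beta> r f t x) (enn2real q) / ennreal t) \<partial>lebesgue)
                (\<alpha> / enn2real q)))
         (1 / \<alpha>))"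

end

theory Submission
  imports Defs
begin

text \<open>
  Let \<open>W(t, x)\<close> be the Whitney average. Covering the unit ball by finitely many balls \<open>B(e, 1/2)\<close> shows
  \<open>W(t, x)\<^sup>q \<le> K \<Sum>\<^sub>e W(t, z + t e)\<^sup>q\<close> whenever \<open>|x - z| < t/2\<close>. For \<open>q < \<infinity>\<close> put
  \<open>G\<^sub>\<tau>(x) = \<integral>\<^sub>0\<^sup>\<tau> W(t, x)\<^sup>q dt/t\<close> and let \<open>V\<^sub>p\<close> be the supremum over all balls \<open>B(y, \<tau>)\<close> of the mean of
  \<open>G\<^sub>\<tau>\<^sup>p\<close>. By Tonelli, \<open>V\<^sub>1\<close> is the \<open>q\<close>-th power of the tent norm, and with \<open>p = \<alpha>/q\<close> the \<open>\<alpha>\<close>-th power of the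
  other side is \<open>V\<^sub>p\<close>. So the claim is a John--Nirenberg type comparison of \<open>V\<^sub>p\<close> with \<open>V\<^sub>1\<^sup>p\<close>.

  Since \<open>G\<^sub>\<tau>\<^bsup>n+1\<^esup> \<le> 2\<^sup>n \<integral>\<^sub>0\<^sup>\<tau> W\<^sup>q G\<^sub>t\<^sup>n dt/t\<close>, and \<open>W(t, x)\<^sup>q\<close> can be averaged over \<open>z \<in> B(x, t/2)\<close>, exchanging
  the integrals in \<open>x\<close> and \<open>z\<close> gives \<open>V\<^bsub>n+1\<^esub> \<le> C V\<^sub>1 V\<^sub>n\<close>, hence \<open>V\<^sub>n \<le> C V\<^sub>1\<^sup>n\<close> for all \<open>n\<close>. Real exponents
  \<open>p\<close> follow from \<open>u\<^sup>a \<le> k\<^sup>a + k\<^bsup>a-b\<^esup> u\<^sup>b\<close> for \<open>a \<le> b\<close>. For the converse with \<open>p < 1\<close> one uses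
  \<open>u \<le> k\<^bsup>1-p\<^esup> u\<^sup>p + u\<^sup>2/k\<close> with \<open>k\<close> a large multiple of \<open>V\<^sub>1\<close>: the second term is absorbed, which is where
  the finiteness of the tent norm enters. For \<open>q = \<infinity>\<close> the covering estimate alone suffices.\<close>

section \<open>Powers of extended nonnegative reals\<close>

lemma ennpowr_top [simp]: "ennpowr top a = top"
  by (simp add: ennpowr_def)

lemma ennpowr_ennreal: "0 \<le> x \<Longrightarrow> ennpowr (ennreal x) a = ennreal (x powr a)"
  by (simp add: ennpowr_def)

lemma ennpowr_0 [simp]: "ennpowr 0 a = 0"
  by (simp add: ennpowr_def)

lemma ennpowr_1 [simp]: "ennpowr x 1 = x"
  by (cases x) (auto simp: ennpowr_def)

lemma ennpowr_mono: "x \<le> y \<Longrightarrow> 0 < a \<Longrightarrow> ennpowr x a \<le> ennpowr y a"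
  by (cases x; cases y) (auto simp: ennpowr_def ennreal_le_iff powr_mono2 top_unique)

lemma ennpowr_ennpowr: "ennpowr (ennpowr x a) b = ennpowr x (a * b)"
  by (cases x) (auto simp: ennpowr_def powr_powr)

lemma ennpowr_mult:
  assumes "0 < a"
  shows "ennpowr (x * y) a = ennpowr x a * ennpowr y a"
proof -
  have *: "ennpowr (\<infinity> * u) a = \<infinity> * ennpowr u a" for u
  proof (cases u)
    case (real v)
    then show ?thesis
      by (cases "v = 0") (auto simp: ennpowr_def ennreal_top_mult)
  qed (simp add: ennpowr_def)
  show ?thesis
    using *[of x] *[of y]
    by (cases x; cases y)
      (auto simp: ennpowr_ennreal powr_mult ennreal_mult[symmetric] mult.commute)
qed

lemma ennpowr_le_iff:
  assumes "0 < a"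
  shows "ennpowr x a \<le> y \<longleftrightarrow> x \<le> ennpowr y (1 / a)"
  using ennpowr_mono[of "ennpowr x a" y "1 / a"] ennpowr_mono[of x "ennpowr y (1 / a)" a] assms
  by (auto simp: ennpowr_ennpowr)

text \<open>By \<open>ennpowr_le_iff\<close> the exponents \<open>a\<close> and \<open>1 / a\<close>
  give mutually inverse monotone maps, and these preserve suprema. This is what pulls the outer
  power out of the suprema in both norms.\<close>

lemma ennpowr_SUP:
  assumes "0 < a"
  shows "ennpowr (SUP i\<in>I. u i) a = (SUP i\<in>I. ennpowr (u i) a)"
proof (rule antisym)
  show "ennpowr (SUP i\<in>I. u i) a \<le> (SUP i\<in>I. ennpowr (u i) a)"
    unfolding ennpowr_le_iff[OF assms]
  proof (rule SUP_least)
    fix i assume "i \<in> I"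
    then have "ennpowr (u i) a \<le> (SUP i\<in>I. ennpowr (u i) a)" by (rule SUP_upper)
    then show "u i \<le> ennpowr (SUP i\<in>I. ennpowr (u i) a) (1 / a)"
      by (simp add: ennpowr_le_iff[OF assms])
  qed
  show "(SUP i\<in>I. ennpowr (u i) a) \<le> ennpowr (SUP i\<in>I. u i) a"
    by (intro SUP_least ennpowr_mono assms SUP_upper)
qed

text \<open>The exponent 0 is excluded because \<open>ennpowr 0 0 = 0\<close>, whereas
  \<open>0 ^ 0 = 1\<close>.\<close>

lemma ennpowr_of_nat: "0 < n \<Longrightarrow> ennpowr x (real n) = x ^ n"
  by (cases x) (auto simp: ennpowr_def powr_realpow' ennreal_power top_power_ennreal)

lemma borel_measurable_ennpowr [measurable (raw)]:
  "u \<in> borel_measurable M \<Longrightarrow> (\<lambda>x. ennpowr (u x) a) \<in> borel_measurable M"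
  unfolding ennpowr_def by simp

text \<open>The sum is at most \<open>card I\<close> times its largest term. The bound is crude, but
  it treats \<open>a \<le> 1\<close> and \<open>a \<ge> 1\<close> alike.\<close>

lemma ennpowr_sum_le:
  assumes "finite I" "0 < a"
  shows "ennpowr (\<Sum>i\<in>I. u i) a \<le> ennreal (real (card I) powr a) * (\<Sum>i\<in>I. ennpowr (u i) a)"
proof (cases "I = {}")
  case False
  define m where "m = Max (u ` I)"
  have "m \<in> u ` I" unfolding m_def using False assms by (intro Max_in) auto
  then obtain j where j: "j \<in> I" "m = u j" by auto
  have "(\<Sum>i\<in>I. u i) \<le> ennreal (real (card I)) * m"
    using sum_bounded_above[of I u m] assms by (simp add: m_def ennreal_of_nat_eq_real_of_nat)
  then have "ennpowr (\<Sum>i\<in>I. u i) a \<le> ennpowr (ennreal (real (card I)) * m) a"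
    by (rule ennpowr_mono) fact
  also have "\<dots> = ennreal (real (card I) powr a) * ennpowr (u j) a"
    using assms by (simp add: ennpowr_mult ennpowr_ennreal j)
  also have "ennpowr (u j) a \<le> (\<Sum>i\<in>I. ennpowr (u i) a)"
    using j assms by (intro member_le_sum) auto
  finally show ?thesis by (simp add: mult_left_mono)
qed simp

text \<open>A substitute for integrating the derivative \<open>(n + 1) * g * H ^ n\<close> of
  \<open>H ^ (n + 1)\<close>, with \<open>2 ^ n\<close> in place of \<open>n + 1\<close>. Since
  \<open>g\<close> and \<open>H\<close> may be infinite, it is proved by induction and Tonelli's
  theorem instead of calculus.\<close>

lemma power_nn_integral_le:
  fixes g :: "real \<Rightarrow> ennreal" and a b :: real
  assumes [measurable]: "g \<in> borel_measurable borel"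
  defines "H \<equiv> \<lambda>t. \<integral>\<^sup>+ s\<in>{a<..<t}. g s \<partial>lborel"
  shows "H b ^ Suc n \<le> 2 ^ n * (\<integral>\<^sup>+ t\<in>{a<..<b}. g t * H t ^ n \<partial>lborel)"
proof (induction n)
  case 0
  then show ?case by (simp add: H_def)
next
  case (Suc n)
  have H_meas [measurable]: "H \<in> borel_measurable borel"
  proof -
    \<comment> \<open>The moving endpoint is written as a condition on the pair of variables, which
      makes the integrand jointly measurable.\<close>
    have "(\<lambda>t. \<integral>\<^sup>+ s. (if a < s \<and> s < t then g s else 0) \<partial>lborel) \<in> borel_measurable borel"
      by measurable
    also have "(\<lambda>t. \<integral>\<^sup>+ s. (if a < s \<and> s < t then g s else 0) \<partial>lborel) = H"
      unfolding H_def by (intro ext nn_integral_cong) (auto simp: indicator_def)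
    finally show ?thesis .
  qed
  have H_mono: "H s \<le> H t" if "s \<le> t" for s t
    unfolding H_def using that by (intro nn_integral_mono) (auto simp: indicator_def)
  define F where "F t = g t * H t ^ n * indicator {a<..<b} t" for t
  have F_meas [measurable]: "F \<in> borel_measurable borel"
    unfolding F_def by measurable
  let ?R = "\<integral>\<^sup>+ t\<in>{a<..<b}. g t * H t ^ Suc n \<partial>lborel"
  \<comment> \<open>The additional factor \<open>H b\<close> is cut at \<open>t\<close>: the part
    below is \<open>H t\<close>, the part above is handled by exchanging the two integrals. The
    point \<open>t\<close> itself is a null set.\<close>
  have split: "F t * H b \<le> F t * H t + F t * (\<integral>\<^sup>+ s\<in>{t<..<b}. g s \<partial>lborel)" for t
  proof (cases "a < t \<and> t < b")
    case True
    have "H b \<le> (\<integral>\<^sup>+ s. g s * indicator {a<..<t} s + g s * indicator {t<..<b} s \<partial>lborel)"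
      unfolding H_def using AE_lborel_singleton[of t]
      by (intro nn_integral_mono_AE) (auto simp: indicator_def)
    also have "\<dots> = H t + (\<integral>\<^sup>+ s\<in>{t<..<b}. g s \<partial>lborel)"
      unfolding H_def by (rule nn_integral_add) auto
    finally have "F t * H b \<le> F t * (H t + (\<integral>\<^sup>+ s\<in>{t<..<b}. g s \<partial>lborel))"
      by (rule mult_left_mono) simp
    then show ?thesis by (simp add: distrib_left)
  qed (auto simp: F_def indicator_def)
  \<comment> \<open>After the exchange, \<open>H t \<le> H s\<close> and the integral of
    \<open>g\<close> over \<open>(a, s)\<close> supplies one more factor \<open>H s\<close>, so this
    part is bounded by \<open>?R\<close> as well.\<close>
  have "(\<integral>\<^sup>+ t. F t * (\<integral>\<^sup>+ s\<in>{t<..<b}. g s \<partial>lborel) \<partial>lborel)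
      = (\<integral>\<^sup>+ t. \<integral>\<^sup>+ s. (if t < s \<and> s < b then F t * g s else 0) \<partial>lborel \<partial>lborel)"
    by (simp flip: nn_integral_cmult)
      (intro nn_integral_cong, auto simp: indicator_def)
  also have "\<dots> = (\<integral>\<^sup>+ s. \<integral>\<^sup>+ t. (if t < s \<and> s < b then F t * g s else 0) \<partial>lborel \<partial>lborel)"
    by (rule lborel_pair.Fubini') measurable
  also have "\<dots> \<le> (\<integral>\<^sup>+ s. \<integral>\<^sup>+ t. (g s * H s ^ n * indicator {a<..<b} s)
        * (g t * indicator {a<..<s} t) \<partial>lborel \<partial>lborel)"
    by (intro nn_integral_mono)
      (auto simp: F_def indicator_def mult_ac intro!: mult_left_mono power_mono H_mono)
  also have "\<dots> = (\<integral>\<^sup>+ s. (g s * H s ^ n * indicator {a<..<b} s) * H s \<partial>lborel)"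
    unfolding H_def by (intro nn_integral_cong nn_integral_cmult) measurable
  also have "\<dots> = ?R" by (simp add: mult_ac)
  finally have second: "(\<integral>\<^sup>+ t. F t * (\<integral>\<^sup>+ s\<in>{t<..<b}. g s \<partial>lborel) \<partial>lborel) \<le> ?R" .
  have inner_meas [measurable]: "(\<lambda>t. \<integral>\<^sup>+ s\<in>{t<..<b}. g s \<partial>lborel) \<in> borel_measurable borel"
  proof -
    have "(\<lambda>t. \<integral>\<^sup>+ s. (if t < s \<and> s < b then g s else 0) \<partial>lborel) \<in> borel_measurable borel"
      by measurable
    also have "(\<lambda>t. \<integral>\<^sup>+ s. (if t < s \<and> s < b then g s else 0) \<partial>lborel)
        = (\<lambda>t. \<integral>\<^sup>+ s\<in>{t<..<b}. g s \<partial>lborel)"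
      by (intro ext nn_integral_cong) (auto simp: indicator_def)
    finally show ?thesis .
  qed
  have "H b ^ Suc (Suc n) = H b * H b ^ Suc n" by simp
  also have "\<dots> \<le> H b * (2 ^ n * (\<integral>\<^sup>+ t. F t \<partial>lborel))"
    using Suc.IH by (intro mult_left_mono) (auto simp: F_def)
  also have "\<dots> = 2 ^ n * (\<integral>\<^sup>+ t. F t * H b \<partial>lborel)"
    by (simp add: nn_integral_multc mult_ac)
  also have "\<dots> \<le> 2 ^ n * (\<integral>\<^sup>+ t. F t * H t + F t * (\<integral>\<^sup>+ s\<in>{t<..<b}. g s \<partial>lborel) \<partial>lborel)"
    by (intro mult_left_mono nn_integral_mono split) simp
  also have "\<dots> = 2 ^ n * ((\<integral>\<^sup>+ t. F t * H t \<partial>lborel)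
      + (\<integral>\<^sup>+ t. F t * (\<integral>\<^sup>+ s\<in>{t<..<b}. g s \<partial>lborel) \<partial>lborel))"
    by (subst nn_integral_add) auto
  also have "(\<integral>\<^sup>+ t. F t * H t \<partial>lborel) = ?R"
    by (simp add: F_def mult_ac)
  also have "2 ^ n * (?R + (\<integral>\<^sup>+ t. F t * (\<integral>\<^sup>+ s\<in>{t<..<b}. g s \<partial>lborel) \<partial>lborel))
      \<le> 2 ^ n * (?R + ?R)"
    by (intro mult_left_mono add_left_mono second) simp
  also have "\<dots> = 2 ^ Suc n * ?R"
    by (simp add: mult_2 distrib_left distrib_right)
  finally show ?case .
qed

section \<open>Moments of the square function\<close>

lemma nn_integral_lborel_translation:
  fixes c :: "'a::euclidean_space"
  assumes [measurable]: "u \<in> borel_measurable borel"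
  shows "(\<integral>\<^sup>+ z. u (z + c) \<partial>lborel) = (\<integral>\<^sup>+ z. u z \<partial>lborel)"
proof -
  have "(\<integral>\<^sup>+ z. u z \<partial>lborel) = (\<integral>\<^sup>+ z. u z \<partial>distr lborel borel ((+) c))"
    by (simp add: lborel_distr_plus)
  also have "\<dots> = (\<integral>\<^sup>+ z. u (z + c) \<partial>lborel)"
    by (subst nn_integral_distr) (auto simp: add.commute)
  finally show ?thesis ..
qed

lemma emeasure_ball_scale:
  fixes x y :: "'a::euclidean_space"
  assumes "0 \<le> c" "0 \<le> r"
  shows "emeasure lborel (ball x (c * r)) = ennreal (c ^ DIM('a)) * emeasure lborel (ball y r)"
  using assms by (simp add: emeasure_ball power_mult_distrib ennreal_mult[symmetric] mult_ac)

lemma emeasure_ball_pos_finite: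
  fixes x :: "'a::euclidean_space"
  assumes "0 < r"
  shows "0 < emeasure lborel (ball x r)" "emeasure lborel (ball x r) < \<infinity>"
  using assms by (auto simp: emeasure_ball ennreal_zero_less_mult_iff)

lemma measurable_mem_ball [measurable (raw)]:
  fixes y :: "'a::euclidean_space"
  shows "u \<in> borel_measurable M \<Longrightarrow> Measurable.pred M (\<lambda>x. u x \<in> ball y r)"
  unfolding mem_ball by measurable

text \<open>An \<open>nn_integral\<close> does not change under completion of the measure, so the
  averages can be computed with \<open>lborel\<close>, where Tonelli's theorem applies to Borel
  functions.\<close>

lemma mean_integral_lborel:
  assumes "A \<in> sets borel"
  shows "mean_integral A u = (\<integral>\<^sup>+ x\<in>A. u x \<partial>lborel) / emeasure lborel A"
  using assms by (simp add: mean_integral_def nn_integral_completion)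

lemma mean_integral_ball_le_iff:
  fixes y :: "'a::euclidean_space"
  assumes "0 < r"
  shows "mean_integral (ball y r) u \<le> c
    \<longleftrightarrow> (\<integral>\<^sup>+ x\<in>ball y r. u x \<partial>lborel) \<le> c * emeasure lborel (ball y r)"
proof -
  let ?b = "emeasure lborel (ball y r)"
  have b: "?b \<noteq> 0" "?b \<noteq> top"
    using emeasure_ball_pos_finite[OF assms, of y] by auto
  then have "mean_integral (ball y r) u \<le> c \<longleftrightarrow> (\<integral>\<^sup>+ x\<in>ball y r. u x \<partial>lborel) / ?b * ?b \<le> c * ?b"
    by (simp add: mean_integral_lborel ennreal_mult_le_mult_iff mult.commute[of _ ?b])
  then show ?thesis
    using b by (simp add: ennreal_divide_times ennreal_divide_self top.not_eq_extremum)
qed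

lemma mean_integral_mono:
  "(\<And>x. x \<in> A \<Longrightarrow> u x \<le> v x) \<Longrightarrow> mean_integral A u \<le> mean_integral A v"
  unfolding mean_integral_def
  by (intro divide_right_mono_ennreal nn_integral_mono) (auto simp: indicator_def)

lemma mean_integral_const_le:
  fixes y :: "'a::euclidean_space"
  assumes "0 < r"
  shows "mean_integral (ball y r) (\<lambda>x. c) \<le> c"
  using assms by (simp add: mean_integral_ball_le_iff nn_integral_cmult_indicator)

lemma mean_integral_add:
  assumes "A \<in> sets borel" "u \<in> borel_measurable borel" "v \<in> borel_measurable borel"
  shows "mean_integral A (\<lambda>x. u x + v x) = mean_integral A u + mean_integral A v"
  using assms by (simp add: mean_integral_lborel distrib_right nn_integral_add add_divide_distrib_ennreal)

lemma mean_integral_cmult: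
  assumes "A \<in> sets borel" "u \<in> borel_measurable borel"
  shows "mean_integral A (\<lambda>x. c * u x) = c * mean_integral A u"
  using assms by (simp add: mean_integral_lborel mult.assoc nn_integral_cmult ennreal_times_divide)

text \<open>Isolates what the moment estimates need to know about powers of Whitney averages. The
  function \<open>f\<close> will enter through \<open>w\<close> only, so bounds in terms of
  \<open>E\<close> and \<open>K\<close> are uniform in \<open>f\<close>.\<close>

locale quasi_constant =
  fixes w :: "real \<Rightarrow> 'a::euclidean_space \<Rightarrow> ennreal" and E :: "'a set" and K :: real
  assumes measurable_w [measurable]: "(\<lambda>(t, x). w t x) \<in> borel_measurable (borel \<Otimes>\<^sub>M borel)"
    and finite_E: "finite E"
    and norm_E: "e \<in> E \<Longrightarrow> norm e \<le> 1"
    and K_nonneg: "0 \<le> K"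
    and quasi_constant: "0 < t \<Longrightarrow> dist x z < t / 2
      \<Longrightarrow> w t x \<le> ennreal K * (\<Sum>e\<in>E. w t (z + t *\<^sub>R e))"
begin

text \<open>This is \<open>G\<^sub>\<tau>\<close> of the overview, and \<open>moment p\<close> below
  is \<open>V\<^sub>p\<close>.\<close>

definition sq_fun :: "real \<Rightarrow> 'a \<Rightarrow> ennreal" where
  "sq_fun \<tau> x = (\<integral>\<^sup>+ t\<in>{0<..<\<tau>}. (w t x / ennreal t) \<partial>lborel)"

definition moment :: "real \<Rightarrow> ennreal" where
  "moment p = (SUP \<tau>\<in>{0<..}. SUP y. mean_integral (ball y \<tau>) (\<lambda>x. ennpowr (sq_fun \<tau> x) p))"

lemma measurable_sq_fun [measurable]:
  "(\<lambda>(t, x). sq_fun t x) \<in> borel_measurable (borel \<Otimes>\<^sub>M borel)"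
proof -
  have "(\<lambda>(t, x). \<integral>\<^sup>+ s. (if 0 < s \<and> s < t then w s x / ennreal s else 0) \<partial>lborel)
      \<in> borel_measurable (borel \<Otimes>\<^sub>M borel)"
    by measurable
  also have "(\<lambda>(t, x). \<integral>\<^sup>+ s. (if 0 < s \<and> s < t then w s x / ennreal s else 0) \<partial>lborel)
      = (\<lambda>(t, x). sq_fun t x)"
    unfolding sq_fun_def by (intro ext) (auto intro!: nn_integral_cong simp: indicator_def)
  finally show ?thesis .
qed

lemma mean_le_moment: "0 < \<tau> \<Longrightarrow> mean_integral (ball y \<tau>) (\<lambda>x. ennpowr (sq_fun \<tau> x) p) \<le> moment p"
  unfolding moment_def by (intro SUP_upper2[of \<tau>] SUP_upper2[of y]) auto

lemma moment_leI:
  "(\<And>\<tau> y. 0 < \<tau> \<Longrightarrow> mean_integral (ball y \<tau>) (\<lambda>x. ennpowr (sq_fun \<tau> x) p) \<le> c) \<Longrightarrow> moment p \<le> c"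
  unfolding moment_def by (intro SUP_least) auto

lemma set_integral_sq_fun:
  "(\<integral>\<^sup>+ x\<in>ball y r. sq_fun \<tau> x \<partial>lborel)
    = (\<integral>\<^sup>+ t\<in>{0<..<\<tau>}. ((\<integral>\<^sup>+ x\<in>ball y r. w t x \<partial>lborel) / ennreal t) \<partial>lborel)"
proof -
  have "(\<integral>\<^sup>+ x\<in>ball y r. sq_fun \<tau> x \<partial>lborel)
      = (\<integral>\<^sup>+ x. \<integral>\<^sup>+ t. w t x / ennreal t * indicator {0<..<\<tau>} t * indicator (ball y r) x \<partial>lborel \<partial>lborel)"
    unfolding sq_fun_def by (intro nn_integral_cong, subst nn_integral_multc) auto
  also have "\<dots> = (\<integral>\<^sup>+ t. \<integral>\<^sup>+ x. w t x / ennreal t * indicator {0<..<\<tau>} t * indicator (ball y r) x \<partial>lborel \<partial>lborel)"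
    by (rule lborel_pair.Fubini') measurable
  also have "\<dots> = (\<integral>\<^sup>+ t. (\<integral>\<^sup>+ x\<in>ball y r. w t x \<partial>lborel) / ennreal t * indicator {0<..<\<tau>} t \<partial>lborel)"
    by (intro nn_integral_cong)
      (simp add: divide_ennreal_def mult_ac flip: nn_integral_cmult nn_integral_multc)
  finally show ?thesis .
qed

text \<open>The exchange of integrals that turns the tent norm into the first moment.\<close>

lemma mean_integral_sq_fun:
  "mean_integral (ball y \<tau>) (sq_fun \<tau>)
    = (\<integral>\<^sup>+ t\<in>{0<..<\<tau>}. (mean_integral (ball y \<tau>) (w t) / ennreal t) \<partial>lborel)"
  by (simp add: mean_integral_lborel set_integral_sq_fun)
    (simp add: divide_ennreal_def mult_ac flip: nn_integral_cmult nn_integral_multc)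

text \<open>By quasi-constancy \<open>w t x\<close> is replaced by its values near the points
  \<open>z\<close> with \<open>dist x z < t / 2\<close>. Integrating in \<open>x\<close> first
  leaves a local average of \<open>sq_fun t x ^ n\<close>, which the moment controls.\<close>

lemma weighted_integral_le:
  assumes t: "0 < t" "t < \<tau>" and n: "0 < n"
  shows "(\<integral>\<^sup>+ x\<in>ball y \<tau>. (w t x * sq_fun t x ^ n) \<partial>lborel)
    \<le> ennreal (K * 2 ^ DIM('a) * real (card E)) * moment (real n) * (\<integral>\<^sup>+ z\<in>ball y (3 * \<tau>). w t z \<partial>lborel)"
proof -
  let ?b = "emeasure lborel (ball (0::'a) (t / 2))"
  let ?J = "\<integral>\<^sup>+ x\<in>ball y \<tau>. (w t x * sq_fun t x ^ n) \<partial>lborel"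
  let ?I = "\<integral>\<^sup>+ z\<in>ball y (3 * \<tau>). w t z \<partial>lborel"
  let ?M = "moment (real n)"
  have b: "emeasure lborel (ball x (t / 2)) = ?b" for x :: 'a
    using t by (simp add: emeasure_ball)
  have b2: "emeasure lborel (ball x t) = ennreal (2 ^ DIM('a)) * ?b" for x :: 'a
    using emeasure_ball_scale[of 2 "t / 2" x 0] t by simp
  \<comment> \<open>The small ball is enlarged to \<open>ball z t\<close>, whose radius matches the
    height of \<open>sq_fun t\<close>; this costs \<open>2 ^ DIM('a)\<close>. If \<open>z\<close> is
    outside \<open>ball y (2 * \<tau>)\<close>, the two balls are disjoint because
    \<open>t / 2 < \<tau>\<close>.\<close>
  have inner: "(\<integral>\<^sup>+ x. indicator (ball y \<tau>) x * (indicator (ball z (t / 2)) x * sq_fun t x ^ n) \<partial>lborel)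
      \<le> ?M * (ennreal (2 ^ DIM('a)) * ?b) * indicator (ball y (2 * \<tau>)) z" for z
  proof (cases "z \<in> ball y (2 * \<tau>)")
    case True
    have "(\<integral>\<^sup>+ x. indicator (ball y \<tau>) x * (indicator (ball z (t / 2)) x * sq_fun t x ^ n) \<partial>lborel)
        \<le> (\<integral>\<^sup>+ x\<in>ball z t. ennpowr (sq_fun t x) (real n) \<partial>lborel)"
      using t n by (intro nn_integral_mono) (auto simp: indicator_def ennpowr_of_nat)
    also have "\<dots> \<le> ?M * emeasure lborel (ball z t)"
      using t mean_le_moment[of t z "real n"] by (simp add: mean_integral_ball_le_iff)
    finally show ?thesis using True by (simp add: b2)
  next
    case False
    have "indicator (ball y \<tau>) x * (indicator (ball z (t / 2)) x * sq_fun t x ^ n) = 0" for x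
      using False t dist_triangle[of y z x] by (auto simp: indicator_def dist_commute)
    then show ?thesis by (simp only: nn_integral_const) simp
  qed
  \<comment> \<open>Translation by \<open>t *\<^sub>R e\<close> moves points by at most
    \<open>t < \<tau>\<close>, hence \<open>ball y (2 * \<tau>)\<close> into
    \<open>ball y (3 * \<tau>)\<close>.\<close>
  have shift: "(\<integral>\<^sup>+ z. w t (z + t *\<^sub>R e) * indicator (ball y (2 * \<tau>)) z \<partial>lborel) \<le> ?I" if "e \<in> E" for e
  proof -
    have "dist y (z + t *\<^sub>R e) < 3 * \<tau>" if "dist y z < 2 * \<tau>" for z
    proof -
      have "dist z (z + t *\<^sub>R e) \<le> t"
        using norm_E[OF \<open>e \<in> E\<close>] t by (simp add: dist_norm mult_left_le)
      then show ?thesis using that t dist_triangle[of y "z + t *\<^sub>R e" z] by simp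
    qed
    then have "(\<integral>\<^sup>+ z. w t (z + t *\<^sub>R e) * indicator (ball y (2 * \<tau>)) z \<partial>lborel)
        \<le> (\<integral>\<^sup>+ z. w t (z + t *\<^sub>R e) * indicator (ball y (3 * \<tau>)) (z + t *\<^sub>R e) \<partial>lborel)"
      by (intro nn_integral_mono) (auto simp: indicator_def)
    also have "\<dots> = ?I"
      by (rule nn_integral_lborel_translation[of "\<lambda>z. w t z * indicator (ball y (3 * \<tau>)) z"]) measurable
    finally show ?thesis .
  qed
  let ?S = "\<lambda>z. \<Sum>e\<in>E. w t (z + t *\<^sub>R e)"
  let ?c = "ennreal K * ?M * (ennreal (2 ^ DIM('a)) * ?b)"
  let ?F = "\<lambda>x z. if dist x z < t / 2
    then ennreal K * ?S z * (sq_fun t x ^ n * indicator (ball y \<tau>) x) else 0"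
  \<comment> \<open>The factor \<open>?b\<close>, the common volume of the balls of radius
    \<open>t / 2\<close>, introduces the variable \<open>z\<close>; it is positive and finite, so it
    cancels at the end.\<close>
  have "?b * ?J = (\<integral>\<^sup>+ x. ?b * (w t x * sq_fun t x ^ n * indicator (ball y \<tau>) x) \<partial>lborel)"
    by (rule nn_integral_cmult[symmetric]) measurable
  also have "\<dots> = (\<integral>\<^sup>+ x. \<integral>\<^sup>+ z. indicator (ball x (t / 2)) z
      * (w t x * sq_fun t x ^ n * indicator (ball y \<tau>) x) \<partial>lborel \<partial>lborel)"
  proof (intro nn_integral_cong)
    fix x
    show "?b * (w t x * sq_fun t x ^ n * indicator (ball y \<tau>) x) = (\<integral>\<^sup>+ z. indicator (ball x (t / 2)) z
        * (w t x * sq_fun t x ^ n * indicator (ball y \<tau>) x) \<partial>lborel)"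
      by (subst nn_integral_multc) (simp_all add: b[of x])
  qed
  also have "\<dots> \<le> (\<integral>\<^sup>+ x. \<integral>\<^sup>+ z. ?F x z \<partial>lborel \<partial>lborel)"
  proof (intro nn_integral_mono)
    fix x z
    show "indicator (ball x (t / 2)) z * (w t x * sq_fun t x ^ n * indicator (ball y \<tau>) x) \<le> ?F x z"
    proof (cases "dist x z < t / 2")
      case True
      then have "w t x * (sq_fun t x ^ n * indicator (ball y \<tau>) x)
          \<le> ennreal K * ?S z * (sq_fun t x ^ n * indicator (ball y \<tau>) x)"
        using t by (intro mult_right_mono quasi_constant) auto
      then show ?thesis using True by (simp add: mult.assoc)
    qed simp
  qed
  also have "\<dots> = (\<integral>\<^sup>+ z. \<integral>\<^sup>+ x. ?F x z \<partial>lborel \<partial>lborel)"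
    by (rule lborel_pair.Fubini') measurable
  also have "\<dots> = (\<integral>\<^sup>+ z. ennreal K * ?S z *
      (\<integral>\<^sup>+ x. indicator (ball y \<tau>) x * (indicator (ball z (t / 2)) x * sq_fun t x ^ n) \<partial>lborel) \<partial>lborel)"
  proof (intro nn_integral_cong)
    fix z
    have "(\<integral>\<^sup>+ x. ?F x z \<partial>lborel) = (\<integral>\<^sup>+ x. ennreal K * ?S z *
        (indicator (ball y \<tau>) x * (indicator (ball z (t / 2)) x * sq_fun t x ^ n)) \<partial>lborel)"
      by (intro nn_integral_cong) (simp add: indicator_def dist_commute)
    also have "\<dots> = ennreal K * ?S z *
        (\<integral>\<^sup>+ x. indicator (ball y \<tau>) x * (indicator (ball z (t / 2)) x * sq_fun t x ^ n) \<partial>lborel)"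
      by (rule nn_integral_cmult) measurable
    finally show "(\<integral>\<^sup>+ x. ?F x z \<partial>lborel) = \<dots>" .
  qed
  also have "\<dots> \<le> (\<integral>\<^sup>+ z. ennreal K * ?S z *
      (?M * (ennreal (2 ^ DIM('a)) * ?b) * indicator (ball y (2 * \<tau>)) z) \<partial>lborel)"
    by (intro nn_integral_mono mult_left_mono inner) simp
  also have "\<dots> = (\<integral>\<^sup>+ z. ?c * (\<Sum>e\<in>E. w t (z + t *\<^sub>R e) * indicator (ball y (2 * \<tau>)) z) \<partial>lborel)"
    by (simp only: sum_distrib_right[symmetric] mult_ac)
  also have "\<dots> = ?c * (\<Sum>e\<in>E. \<integral>\<^sup>+ z. w t (z + t *\<^sub>R e) * indicator (ball y (2 * \<tau>)) z \<partial>lborel)"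
    by (subst nn_integral_cmult, measurable, subst nn_integral_sum, measurable)
  also have "\<dots> \<le> ?c * (\<Sum>e\<in>E. ?I)"
    by (intro mult_left_mono sum_mono shift) simp_all
  also have "\<dots> = ?b * (ennreal (K * 2 ^ DIM('a) * real (card E)) * ?M * ?I)"
    using K_nonneg by (simp add: ennreal_mult ennreal_of_nat_eq_real_of_nat mult_ac)
  finally have "?b * ?J \<le> ?b * (ennreal (K * 2 ^ DIM('a) * real (card E)) * ?M * ?I)" .
  then show ?thesis
    using emeasure_ball_pos_finite[of "t / 2" "0 :: 'a"] t
    by (subst (asm) ennreal_mult_le_mult_iff) auto
qed

text \<open>\<open>power_nn_integral_le\<close> reduces the power \<open>n + 1\<close> to an
  integral over \<open>t\<close> of the expression in \<open>weighted_integral_le\<close>. What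
  remains is a first moment over the ball of triple radius, which explains
  \<open>3 ^ DIM('a)\<close>.\<close>

lemma moment_Suc_le:
  assumes n: "0 < n"
  shows "moment (real (Suc n))
    \<le> ennreal (2 ^ n * (K * 2 ^ DIM('a) * real (card E)) * 3 ^ DIM('a)) * moment 1 * moment (real n)"
proof (rule moment_leI)
  fix \<tau> :: real and y :: 'a
  assume \<tau>: "0 < \<tau>"
  let ?L = "ennreal (K * 2 ^ DIM('a) * real (card E))"
  let ?b = "emeasure lborel (ball y \<tau>)"
  let ?M = "moment (real n)"
  have b3: "emeasure lborel (ball y (3 * \<tau>)) = ennreal (3 ^ DIM('a)) * ?b"
    using emeasure_ball_scale[of 3 \<tau> y y] \<tau> by simp
  have pos: "(\<integral>\<^sup>+ t\<in>{0<..<3 * \<tau>}. (\<integral>\<^sup>+ z\<in>ball y (3 * \<tau>). w t z \<partial>lborel) / ennreal t \<partial>lborel)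
      \<le> moment 1 * emeasure lborel (ball y (3 * \<tau>))"
  proof -
    show ?thesis
      using mean_le_moment[of "3 * \<tau>" y 1] \<tau>
      by (simp add: mean_integral_ball_le_iff set_integral_sq_fun)
  qed
  have "(\<integral>\<^sup>+ x\<in>ball y \<tau>. ennpowr (sq_fun \<tau> x) (real (Suc n)) \<partial>lborel)
      = (\<integral>\<^sup>+ x\<in>ball y \<tau>. sq_fun \<tau> x ^ Suc n \<partial>lborel)"
    by (simp only: ennpowr_of_nat zero_less_Suc)
  also have "\<dots> \<le> (\<integral>\<^sup>+ x\<in>ball y \<tau>. 2 ^ n * (\<integral>\<^sup>+ t\<in>{0<..<\<tau>}. w t x / ennreal t * sq_fun t x ^ n \<partial>lborel) \<partial>lborel)"
    unfolding sq_fun_def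
    by (intro nn_integral_mono mult_right_mono power_nn_integral_le) auto
  also have "\<dots> = 2 ^ n * (\<integral>\<^sup>+ x. \<integral>\<^sup>+ t. w t x / ennreal t * sq_fun t x ^ n
      * indicator {0<..<\<tau>} t * indicator (ball y \<tau>) x \<partial>lborel \<partial>lborel)"
    by (simp add: nn_integral_cmult mult.assoc flip: nn_integral_multc)
  also have "(\<integral>\<^sup>+ x. \<integral>\<^sup>+ t. w t x / ennreal t * sq_fun t x ^ n
      * indicator {0<..<\<tau>} t * indicator (ball y \<tau>) x \<partial>lborel \<partial>lborel)
     = (\<integral>\<^sup>+ t. \<integral>\<^sup>+ x. w t x / ennreal t * sq_fun t x ^ n
      * indicator {0<..<\<tau>} t * indicator (ball y \<tau>) x \<partial>lborel \<partial>lborel)"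
    by (rule lborel_pair.Fubini') measurable
  also have "\<dots> = (\<integral>\<^sup>+ t. indicator {0<..<\<tau>} t / ennreal t
      * (\<integral>\<^sup>+ x\<in>ball y \<tau>. (w t x * sq_fun t x ^ n) \<partial>lborel) \<partial>lborel)"
    by (intro nn_integral_cong)
      (simp add: divide_ennreal_def mult_ac flip: nn_integral_cmult nn_integral_multc)
  \<comment> \<open>The heights are extended up to \<open>3 * \<tau>\<close> because
    \<open>moment\<close> requires the height to equal the radius of the ball.\<close>
  also have "\<dots> \<le> (\<integral>\<^sup>+ t. indicator {0<..<3 * \<tau>} t / ennreal t
      * (?L * ?M * (\<integral>\<^sup>+ z\<in>ball y (3 * \<tau>). w t z \<partial>lborel)) \<partial>lborel)"
  proof (intro nn_integral_mono)
    fix t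
    show "indicator {0<..<\<tau>} t / ennreal t * (\<integral>\<^sup>+ x\<in>ball y \<tau>. (w t x * sq_fun t x ^ n) \<partial>lborel)
        \<le> indicator {0<..<3 * \<tau>} t / ennreal t * (?L * ?M * (\<integral>\<^sup>+ z\<in>ball y (3 * \<tau>). w t z \<partial>lborel))"
    proof (cases "0 < t \<and> t < \<tau>")
      case True
      then show ?thesis
        using weighted_integral_le[OF _ _ n, of t \<tau> y] by (intro mult_mono) simp_all
    qed simp
  qed
  also have "\<dots> = ?L * ?M *
      (\<integral>\<^sup>+ t\<in>{0<..<3 * \<tau>}. (\<integral>\<^sup>+ z\<in>ball y (3 * \<tau>). w t z \<partial>lborel) / ennreal t \<partial>lborel)"
    by (simp add: divide_ennreal_def mult_ac flip: nn_integral_cmult)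
  also have "\<dots> \<le> ?L * ?M * (moment 1 * emeasure lborel (ball y (3 * \<tau>)))"
    by (intro mult_left_mono pos) simp
  finally have "(\<integral>\<^sup>+ x\<in>ball y \<tau>. ennpowr (sq_fun \<tau> x) (real (Suc n)) \<partial>lborel)
      \<le> 2 ^ n * (?L * ?M * (moment 1 * (ennreal (3 ^ DIM('a)) * ?b)))"
    by (simp add: mult_left_mono b3)
  also have "\<dots> = ennreal (2 ^ n * (K * 2 ^ DIM('a) * real (card E)) * 3 ^ DIM('a)) * moment 1 * ?M * ?b"
    using K_nonneg by (simp add: ennreal_mult mult_ac flip: ennreal_power)
  finally show "mean_integral (ball y \<tau>) (\<lambda>x. ennpowr (sq_fun \<tau> x) (real (Suc n)))
    \<le> ennreal (2 ^ n * (K * 2 ^ DIM('a) * real (card E)) * 3 ^ DIM('a)) * moment 1 * ?M"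
    using \<tau> by (simp add: mean_integral_ball_le_iff)
qed

end

section \<open>Comparison of moments\<close>

text \<open>The first term dominates for \<open>x \<le> k\<close>, the second for
  \<open>x > k\<close>.\<close>

lemma ennpowr_interpolate_above:
  assumes "0 < a" "a \<le> b" "0 < k"
  shows "ennpowr x a \<le> ennreal (k powr a) + ennreal (k powr (a - b)) * ennpowr x b"
proof (cases x)
  case (real u)
  have "u powr a \<le> k powr a + k powr (a - b) * u powr b"
  proof (cases "u \<le> k")
    case True
    then have "u powr a \<le> k powr a"
      using real assms by (intro powr_mono2) auto
    then show ?thesis by (simp add: add_increasing2)
  next
    case False
    have "u powr a = u powr (a - b) * u powr b"
      by (simp flip: powr_add)
    also have "\<dots> \<le> k powr (a - b) * u powr b"
      using False assms by (intro mult_right_mono powr_mono2') auto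
    finally show ?thesis by (simp add: add_increasing)
  qed
  then show ?thesis
    using real assms by (simp add: ennpowr_ennreal flip: ennreal_mult ennreal_plus)
next
  case top
  then show ?thesis using assms by (simp add: ennreal_mult_top)
qed

text \<open>Again split at the level \<open>k\<close>. A large \<open>k\<close> makes the
  coefficient of the square small, which later allows absorption.\<close>

lemma ennpowr_interpolate_below:
  assumes "0 < p" "p < 1" "0 < k"
  shows "x \<le> ennreal (k powr (1 - p)) * ennpowr x p + ennreal (1 / k) * x\<^sup>2"
proof (cases x)
  case (real u)
  have "u \<le> k powr (1 - p) * u powr p + 1 / k * u\<^sup>2"
  proof (cases "u \<le> k")
    case True
    have "u = u powr (1 - p) * u powr p"
      using real by (simp flip: powr_add)
    also have "\<dots> \<le> k powr (1 - p) * u powr p"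
      using True real assms by (intro mult_right_mono powr_mono2) auto
    finally show ?thesis using assms by (simp add: add_increasing2)
  next
    case False
    then have "u * k \<le> u * u" using real by (intro mult_left_mono) auto
    then have "u \<le> 1 / k * u\<^sup>2" using assms by (simp add: pos_le_divide_eq power2_eq_square)
    then show ?thesis by (simp add: add_increasing)
  qed
  then show ?thesis
    using real assms by (simp add: ennpowr_ennreal ennreal_power flip: ennreal_mult ennreal_plus)
next
  case top
  then show ?thesis using assms by (simp add: ennreal_mult_top)
qed

text \<open>Interpolation needs a positive real level \<open>k\<close>, whereas \<open>y\<close> may
  be 0 or infinite. For finite \<open>y\<close> the levels decrease to \<open>y\<close>; for
  infinite \<open>y\<close> the right-hand side is infinite.\<close>

lemma le_ennpowr_limit:
  assumes "0 < a" "0 < c"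
    and le: "\<And>k. 0 < k \<Longrightarrow> y \<le> ennreal k \<Longrightarrow> x \<le> ennreal (c * k powr a)"
  shows "x \<le> ennpowr (ennreal (c powr (1 / a)) * y) a"
proof (cases y)
  case (real v)
  let ?c = "c powr (1 / a)"
  have bound: "ennpowr x (1 / a) \<le> ennreal (?c * k)" if "v < k" for k
  proof -
    have k: "0 < k" using that real by simp
    have "x \<le> ennreal (c * k powr a)"
      using k that real by (intro le) (auto intro: ennreal_leI)
    then have "ennpowr x (1 / a) \<le> ennpowr (ennreal (c * k powr a)) (1 / a)"
      using assms by (intro ennpowr_mono) auto
    then show ?thesis
      using assms k by (simp add: ennpowr_ennreal powr_mult powr_powr)
  qed
  have "ennpowr x (1 / a) < top"
    using bound[of "v + 1"] by (auto simp: le_less_trans)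
  then obtain u where u: "0 \<le> u" "ennpowr x (1 / a) = ennreal u"
    by (cases "ennpowr x (1 / a)") auto
  have c: "0 < ?c" using assms by simp
  have "u / ?c \<le> v"
  proof (rule dense_ge)
    fix k assume "v < k"
    then show "u / ?c \<le> k"
      using bound[of k] u real c by (simp add: pos_divide_le_eq mult.commute)
  qed
  then have "ennpowr x (1 / a) \<le> ennreal ?c * y"
    using u real c by (simp add: pos_divide_le_eq mult.commute flip: ennreal_mult)
  then show ?thesis
    using assms by (subst (asm) ennpowr_le_iff) auto
next
  case top
  then show ?thesis using assms by (simp add: ennreal_mult_top)
qed

context quasi_constant
begin

text \<open>Averaging over a ball is monotone and linear and does not increase constants, so a
  pointwise inequality between powers passes to moments.\<close>

lemma moment_le_linear:
  assumes le: "\<And>x. ennpowr x p \<le> a + b * ennpowr x r + c * ennpowr x s"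
  shows "moment p \<le> a + b * moment r + c * moment s"
proof (rule moment_leI)
  fix \<tau> :: real and y :: 'a
  assume \<tau>: "0 < \<tau>"
  let ?m = "mean_integral (ball y \<tau>)"
  have "?m (\<lambda>x. ennpowr (sq_fun \<tau> x) p)
      \<le> ?m (\<lambda>x. a + b * ennpowr (sq_fun \<tau> x) r + c * ennpowr (sq_fun \<tau> x) s)"
    by (intro mean_integral_mono le)
  also have "\<dots> = ?m (\<lambda>x. a) + b * ?m (\<lambda>x. ennpowr (sq_fun \<tau> x) r)
      + c * ?m (\<lambda>x. ennpowr (sq_fun \<tau> x) s)"
    by (simp add: mean_integral_add mean_integral_cmult)
  also have "\<dots> \<le> a + b * moment r + c * moment s"
    using \<tau> by (intro add_mono mult_left_mono mean_integral_const_le mean_le_moment) auto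
  finally show "?m (\<lambda>x. ennpowr (sq_fun \<tau> x) p) \<le> a + b * moment r + c * moment s" .
qed

text \<open>Jensen's inequality for \<open>a \<le> b\<close> with a weaker constant: interpolating
  at the level \<open>k\<close> makes both terms multiples of \<open>k powr a\<close>.\<close>

lemma moment_le_of_higher:
  assumes "0 < a" "a \<le> b" "0 < k" "0 \<le> c" "moment b \<le> ennreal (c * k powr b)"
  shows "moment a \<le> ennreal ((1 + c) * k powr a)"
proof -
  have "moment a \<le> ennreal (k powr a) + ennreal (k powr (a - b)) * moment b"
    using moment_le_linear[of a _ _ b 0 b] ennpowr_interpolate_above[OF assms(1-3)] by simp
  also have "\<dots> \<le> ennreal (k powr a) + ennreal (k powr (a - b)) * ennreal (c * k powr b)"
    using assms by (intro add_left_mono mult_left_mono) auto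
  also have "\<dots> = ennreal (k powr a + k powr (a - b) * (c * k powr b))"
    using assms by (simp flip: ennreal_mult ennreal_plus)
  also have "k powr (a - b) * (c * k powr b) = c * k powr a"
    using assms by (simp add: powr_diff)
  finally show ?thesis by (simp add: distrib_right)
qed

text \<open>The product of the constants of \<open>moment_Suc_le\<close>. Adding 1 keeps every
  factor positive even if \<open>K = 0\<close> or \<open>E\<close> is empty. Only \<open>E\<close>
  and \<open>K\<close> enter, not \<open>w\<close>.\<close>

definition growth :: "nat \<Rightarrow> real" where
  "growth n = (\<Prod>k\<in>{1..<n}. 2 ^ k * (1 + K * 2 ^ DIM('a) * real (card E) * 3 ^ DIM('a)))"

lemma growth_pos: "0 < growth n"
  using K_nonneg unfolding growth_def by (intro prod_pos) (auto intro!: mult_pos_pos add_pos_nonneg)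

lemma moment_of_nat_le: "0 < n \<Longrightarrow> moment (real n) \<le> ennreal (growth n) * moment 1 ^ n"
proof (induction n rule: nat_induct_non_zero)
  case 1
  then show ?case by (simp add: growth_def)
next
  case (Suc n)
  let ?B = "K * 2 ^ DIM('a) * real (card E) * 3 ^ DIM('a)"
  have B: "0 \<le> ?B" using K_nonneg by simp
  have "moment (real (Suc n)) \<le> ennreal (2 ^ n * ?B) * moment 1 * moment (real n)"
    using moment_Suc_le[OF Suc.hyps] by (simp add: mult_ac)
  also have "\<dots> \<le> ennreal (2 ^ n * (1 + ?B)) * moment 1 * (ennreal (growth n) * moment 1 ^ n)"
    using B Suc.IH by (intro mult_mono ennreal_leI mult_left_mono) auto
  also have "\<dots> = ennreal (2 ^ n * (1 + ?B) * growth n) * moment 1 ^ Suc n"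
    using B growth_pos[of n] by (simp add: ennreal_mult less_imp_le mult_ac)
  also have "2 ^ n * (1 + ?B) * growth n = growth (Suc n)"
    using Suc.hyps by (simp add: growth_def atLeastLessThanSuc mult_ac)
  finally show ?case .
qed

text \<open>Round \<open>p\<close> up to an integer, use the integer bound there, and come back down
  with \<open>moment_le_of_higher\<close>.\<close>

lemma moment_le_moment_1:
  assumes p: "0 < p"
  shows "moment p \<le> ennpowr (ennreal ((1 + growth (nat \<lceil>p\<rceil>)) powr (1 / p)) * moment 1) p"
proof (rule le_ennpowr_limit)
  fix k :: real assume k: "0 < k" "moment 1 \<le> ennreal k"
  let ?n = "nat \<lceil>p\<rceil>"
  have n: "0 < ?n" "p \<le> real ?n" using p by linarith+
  have "moment (real ?n) \<le> ennreal (growth ?n) * moment 1 ^ ?n"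
    using n by (intro moment_of_nat_le)
  also have "\<dots> \<le> ennreal (growth ?n) * ennreal k ^ ?n"
    using k by (intro mult_left_mono power_mono) auto
  also have "\<dots> = ennreal (growth ?n * k powr real ?n)"
    using k growth_pos[of ?n] by (simp add: ennreal_mult ennreal_power powr_realpow)
  finally show "moment p \<le> ennreal ((1 + growth ?n) * k powr p)"
    using p n k growth_pos[of ?n] by (intro moment_le_of_higher) auto
qed (use p growth_pos[of "nat \<lceil>p\<rceil>"] in auto)

lemma moment_1_le_moment:
  assumes p: "1 \<le> p"
  shows "moment 1 \<le> ennreal 2 * ennpowr (moment p) (1 / p)"
proof -
  have "moment 1 \<le> ennpowr (ennreal (2 powr (1 / 1)) * ennpowr (moment p) (1 / p)) 1"
  proof (rule le_ennpowr_limit)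
    fix k :: real assume k: "0 < k" "ennpowr (moment p) (1 / p) \<le> ennreal k"
    then have "moment p \<le> ennreal (1 * k powr p)"
      using p by (simp add: ennpowr_le_iff ennpowr_ennreal)
    then show "moment 1 \<le> ennreal (2 * k powr 1)"
      using moment_le_of_higher[of 1 p k 1] p k by simp
  qed auto
  then show ?thesis by simp
qed

text \<open>The first moment is bounded by the \<open>p\<close>-th and the second moment; the latter
  is at most \<open>growth 2 * moment 1 ^ 2\<close> and is absorbed into the left-hand side.\<close>

lemma moment_1_le_lower_moment:
  assumes p: "0 < p" "p < 1" and fin: "moment 1 < \<infinity>"
  shows "moment 1 \<le> ennreal ((2 * (2 * growth 2) powr (1 - p)) powr (1 / p)) * ennpowr (moment p) (1 / p)"
proof (cases "moment p")
  case (real m)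
  let ?c = "growth 2"
  obtain v where v: "0 \<le> v" "moment 1 = ennreal v"
    using fin by (cases "moment 1") auto
  show ?thesis
  proof (cases "v = 0")
    case False
    \<comment> \<open>Chosen so that the second-moment term \<open>growth 2 * v\<^sup>2 / k\<close>
      is exactly \<open>v / 2\<close>.\<close>
    define k where "k = 2 * ?c * v"
    have c: "0 < ?c" by (rule growth_pos)
    then have k: "0 < k" using False v by (simp add: k_def)
    have "x \<le> ennreal (k powr (1 - p)) * ennpowr x p + ennreal (1 / k) * ennpowr x (real 2)" for x
      using ennpowr_interpolate_below[OF p k, of x] ennpowr_of_nat[of 2 x] by simp
    then have "moment 1 \<le> ennreal (k powr (1 - p)) * moment p + ennreal (1 / k) * moment (real 2)"
      using moment_le_linear[of 1 0 _ p _ "real 2"] by simp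
    also have "\<dots> \<le> ennreal (k powr (1 - p)) * moment p + ennreal (1 / k) * (ennreal ?c * moment 1 ^ 2)"
      by (intro add_left_mono mult_left_mono moment_of_nat_le) auto
    also have "\<dots> = ennreal (k powr (1 - p) * m + 1 / k * (?c * v\<^sup>2))"
      using real v k c by (simp add: ennreal_power flip: ennreal_mult ennreal_plus)
    finally have "v \<le> k powr (1 - p) * m + 1 / k * (?c * v\<^sup>2)"
      using v real k c by (subst (asm) v(2)) (simp del: ennreal_plus)
    also have "1 / k * (?c * v\<^sup>2) = v / 2"
      using False c by (simp add: k_def power2_eq_square)
    \<comment> \<open>Subtracting \<open>v / 2\<close> gives the factor 2, and
      \<open>k powr (1 - p)\<close> contributes \<open>v powr (1 - p)\<close>, which is cancelled
      next since \<open>v\<close> is nonzero.\<close>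
    finally have "v \<le> 2 * (2 * ?c) powr (1 - p) * m * v powr (1 - p)"
      using v c by (simp add: k_def powr_mult mult_ac)
    then have "v powr p * v powr (1 - p) \<le> 2 * (2 * ?c) powr (1 - p) * m * v powr (1 - p)"
      using v by (simp flip: powr_add)
    then have "v powr p \<le> 2 * (2 * ?c) powr (1 - p) * m"
      using v False by simp
    then have "(v powr p) powr (1 / p) \<le> (2 * (2 * ?c) powr (1 - p) * m) powr (1 / p)"
      using p by (intro powr_mono2) auto
    then have "v \<le> (2 * (2 * ?c) powr (1 - p)) powr (1 / p) * m powr (1 / p)"
      using p v c real by (simp add: powr_powr powr_mult)
    then show ?thesis
      using real v by (simp add: ennpowr_ennreal flip: ennreal_mult)
  qed (use v in simp)
next
  case top
  then show ?thesis using growth_pos[of 2] by (simp add: ennreal_mult_top)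
qed

lemma moment_1_le:
  assumes p: "0 < p" and fin: "moment 1 < \<infinity>"
  shows "moment 1 \<le> ennreal (2 + (2 * (2 * growth 2) powr (1 - p)) powr (1 / p)) * ennpowr (moment p) (1 / p)"
proof (cases "1 \<le> p")
  case True
  show ?thesis
    by (rule order_trans[OF moment_1_le_moment[OF True]]) (intro mult_right_mono ennreal_leI, auto)
next
  case False
  show ?thesis
    by (rule order_trans[OF moment_1_le_lower_moment[OF p _ fin]])
      (use False in \<open>auto intro!: mult_right_mono ennreal_leI\<close>)
qed

end

section \<open>Whitney averages\<close>

abbreviation whitney_box :: "real \<Rightarrow> 'a::euclidean_space \<Rightarrow> (real \<times> 'a) set" where
  "whitney_box t x \<equiv> {t / 2<..t} \<times> ball x t"

lemma whitney_box_sets: "whitney_box t x \<in> sets borel"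
  by (intro borel_Times) auto

lemma emeasure_whitney_box:
  fixes x :: "'a::euclidean_space"
  assumes "0 < t"
  shows "emeasure lborel (whitney_box t x) = ennreal (t / 2) * emeasure lborel (ball x t)"
proof -
  have "emeasure lborel (whitney_box t x) = emeasure (lborel \<Otimes>\<^sub>M lborel) (whitney_box t x)"
    by (simp add: lborel_prod)
  also have "\<dots> = emeasure lborel {t / 2<..t} * emeasure lborel (ball x t)"
    by (rule lborel.emeasure_pair_measure_Times) auto
  finally show ?thesis using assms by simp
qed

text \<open>One factor 2 comes from the height interval, \<open>2 ^ DIM('a)\<close> from the
  ball.\<close>

lemma emeasure_whitney_box_le:
  fixes x y :: "'a::euclidean_space"
  assumes "0 < s" "s \<le> 2 * t"
  shows "emeasure lborel (whitney_box s y) \<le> ennreal (2 ^ (DIM('a) + 1)) * emeasure lborel (whitney_box t x)"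
proof -
  have t: "0 < t" using assms by simp
  have "emeasure lborel (ball y s) \<le> emeasure lborel (ball y (2 * t))"
    using assms by (intro emeasure_mono) auto
  also have "\<dots> = ennreal (2 ^ DIM('a)) * emeasure lborel (ball x t)"
    using t by (intro emeasure_ball_scale) auto
  finally have "ennreal (s / 2) * emeasure lborel (ball y s)
      \<le> ennreal (2 * (t / 2)) * (ennreal (2 ^ DIM('a)) * emeasure lborel (ball x t))"
    using assms by (intro mult_mono ennreal_leI) auto
  also have "\<dots> = ennreal (2 ^ (DIM('a) + 1)) * (ennreal (t / 2) * emeasure lborel (ball x t))"
    using t by (simp only: ennreal_mult power_add power_one_right) (simp add: ennreal_mult mult_ac)
  finally show ?thesis using assms t by (simp add: emeasure_whitney_box)
qed

locale half_space_fun =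
  fixes f :: "real \<times> (real ^ 'n::finite) \<Rightarrow> complex" and \<beta> :: real
  assumes measurable_f: "f \<in> borel_measurable (lebesgue_on ({0<..} \<times> UNIV))"
begin

text \<open>A Borel measurable representative of the weighted absolute value, which is only Lebesgue measurable.\<close>

definition rep :: "real \<times> (real ^ 'n) \<Rightarrow> real" where
  "rep = (SOME g. g \<in> borel_measurable borel \<and>
    (AE p in lborel. 0 < fst p \<longrightarrow> weighted_abs \<beta> f (fst p) (snd p) = g p))"

lemma rep:
  shows measurable_rep [measurable]: "rep \<in> borel_measurable borel"
    and AE_rep: "AE p in lborel. 0 < fst p \<longrightarrow> weighted_abs \<beta> f (fst p) (snd p) = rep p"
proof -
  let ?H = "{0<..} \<times> UNIV :: (real \<times> (real ^ 'n)) set"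
  have H: "?H \<in> sets lebesgue"
    by (intro sets_completionI_sets) (auto intro!: borel_open open_Times)
  \<comment> \<open>Measurability of \<open>f\<close> is known on the half-space only, so
    \<open>f\<close> is extended by zero.\<close>
  have [measurable]: "(\<lambda>p. if p \<in> ?H then f p else 0) \<in> borel_measurable lebesgue"
    using measurable_f borel_measurable_if[OF H, of f] by simp
  have [measurable]: "(\<lambda>p :: real \<times> (real ^ 'n). fst p powr (- \<beta>)) \<in> borel_measurable lebesgue"
    by (intro measurable_completion) (simp add: borel_prod[symmetric])
  have "(\<lambda>p. norm ((fst p powr (- \<beta>)) *\<^sub>R (if p \<in> ?H then f p else 0))) \<in> borel_measurable lebesgue"
    by measurable
  then obtain g where "g \<in> borel_measurable lborel"
    and "AE p in lborel. norm ((fst p powr (- \<beta>)) *\<^sub>R (if p \<in> ?H then f p else 0)) = g p"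
    using completion_ex_borel_measurable_real by blast
  then have "g \<in> borel_measurable borel \<and>
    (AE p in lborel. 0 < fst p \<longrightarrow> weighted_abs \<beta> f (fst p) (snd p) = g p)"
    by (auto simp: weighted_abs_def elim!: eventually_mono)
  then have "rep \<in> borel_measurable borel \<and>
    (AE p in lborel. 0 < fst p \<longrightarrow> weighted_abs \<beta> f (fst p) (snd p) = rep p)"
    unfolding rep_def by (rule someI[of "\<lambda>g. g \<in> borel_measurable borel \<and>
      (AE p in lborel. 0 < fst p \<longrightarrow> weighted_abs \<beta> f (fst p) (snd p) = g p)"])
  then show "rep \<in> borel_measurable borel"
    and "AE p in lborel. 0 < fst p \<longrightarrow> weighted_abs \<beta> f (fst p) (snd p) = rep p" by auto
qed

text \<open>The almost everywhere equality with \<open>rep\<close> on the product passes to almost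
  every height \<open>s\<close>. Once \<open>f\<close> is replaced by \<open>rep\<close>, Tonelli's
  theorem merges the iterated averages into one average over the box.\<close>

lemma whitney_avg_finite:
  assumes "r \<noteq> \<infinity>" "0 < t"
  shows "whitney_avg \<beta> r f t x =
    ennpowr ((\<integral>\<^sup>+ p\<in>whitney_box t x. ennreal (rep p powr enn2real r) \<partial>lborel)
      / emeasure lborel (whitney_box t x)) (1 / enn2real r)"
proof -
  let ?\<rho> = "enn2real r"
  let ?b = "emeasure lborel (ball x t)"
  let ?u = "\<lambda>p. ennreal (rep p powr ?\<rho>)"
  have [measurable]: "rep \<in> borel_measurable (borel \<Otimes>\<^sub>M borel)"
    by (simp add: borel_prod)
  have "AE p in lborel \<Otimes>\<^sub>M lborel. 0 < fst p \<longrightarrow> weighted_abs \<beta> f (fst p) (snd p) = rep p"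
    using AE_rep by (simp only: lborel_prod)
  then have "AE s in lborel. AE z in lborel. 0 < s \<longrightarrow> weighted_abs \<beta> f s z = rep (s, z)"
    using lborel_pair.AE_pair[of "\<lambda>p. 0 < fst p \<longrightarrow> weighted_abs \<beta> f (fst p) (snd p) = rep p"]
    by simp
  then have "(\<integral>\<^sup>+ s\<in>{t / 2<..t}. mean_integral (ball x t) (\<lambda>z. ennreal (weighted_abs \<beta> f s z powr ?\<rho>)) \<partial>lborel)
      = (\<integral>\<^sup>+ s. (\<integral>\<^sup>+ z\<in>ball x t. ?u (s, z) \<partial>lborel) / ?b * indicator {t / 2<..t} s \<partial>lborel)"
  proof (intro nn_integral_cong_AE, eventually_elim)
    case (elim s)
    show ?case
    proof (cases "s \<in> {t / 2<..t}")
      case True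
      then have "0 < s" using assms by simp
      with elim have "AE z in lborel. weighted_abs \<beta> f s z = rep (s, z)" by simp
      then have "(\<integral>\<^sup>+ z\<in>ball x t. ennreal (weighted_abs \<beta> f s z powr ?\<rho>) \<partial>lborel)
          = (\<integral>\<^sup>+ z\<in>ball x t. ?u (s, z) \<partial>lborel)"
        by (intro nn_integral_cong_AE) (auto elim!: eventually_mono)
      then show ?thesis by (simp add: mean_integral_lborel)
    qed simp
  qed
  also have "\<dots> = (\<integral>\<^sup>+ s. (\<integral>\<^sup>+ z. ?u (s, z) * indicator (whitney_box t x) (s, z) \<partial>lborel) / ?b \<partial>lborel)"
    by (simp add: indicator_times divide_ennreal_def mult_ac flip: nn_integral_cmult nn_integral_multc)
  also have "\<dots> = (\<integral>\<^sup>+ s. \<integral>\<^sup>+ z. ?u (s, z) * indicator (whitney_box t x) (s, z) \<partial>lborel \<partial>lborel) / ?b"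
    by (subst nn_integral_divide) (auto simp: indicator_times)
  also have "(\<integral>\<^sup>+ s. \<integral>\<^sup>+ z. ?u (s, z) * indicator (whitney_box t x) (s, z) \<partial>lborel \<partial>lborel)
      = (\<integral>\<^sup>+ p\<in>whitney_box t x. ?u p \<partial>(lborel \<Otimes>\<^sub>M lborel))"
    by (rule lborel.nn_integral_fst) (auto simp: indicator_times)
  finally have "(\<integral>\<^sup>+ s\<in>{t / 2<..t}. mean_integral (ball x t) (\<lambda>z. ennreal (weighted_abs \<beta> f s z powr ?\<rho>)) \<partial>lborel)
      = (\<integral>\<^sup>+ p\<in>whitney_box t x. ?u p \<partial>lborel) / ?b"
    by (simp add: lborel_prod)
  then show ?thesis
    using assms emeasure_ball_pos_finite[of t x]
    by (simp add: whitney_avg_def mean_integral_lborel emeasure_whitney_box divide_ennreal_def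
        ennreal_inverse_mult mult_ac)
qed

lemma whitney_avg_infinite_le_iff:
  assumes r: "r = \<infinity>" and t: "0 < t"
  shows "whitney_avg \<beta> r f t x \<le> c
    \<longleftrightarrow> (AE p in lborel. p \<in> whitney_box t x \<longrightarrow> ennreal (rep p) \<le> c)"
proof -
  let ?B = "whitney_box t x"
  let ?h = "\<lambda>(s, z). ennreal (weighted_abs \<beta> f s z)"
  have B: "?B \<in> sets lebesgue" using whitney_box_sets by (intro sets_completionI_sets) auto
  have sub: "?B \<subseteq> {0<..} \<times> UNIV" using t by auto
  have f: "f \<in> borel_measurable (lebesgue_on ?B)"
    using measurable_f sub by (rule measurable_restrict_mono)
  have w: "(\<lambda>p :: real \<times> (real ^ 'n). fst p powr (- \<beta>)) \<in> borel_measurable (lebesgue_on ?B)"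
    by (intro measurable_restrict_space1 measurable_completion) (simp add: borel_prod[symmetric])
  \<comment> \<open>\<open>esssup\<close> takes the default value \<open>top\<close> on
    non-measurable functions, so upper bounds on it require this.\<close>
  have h: "?h \<in> borel_measurable (lebesgue_on ?B)"
    unfolding weighted_abs_def case_prod_beta using f w by simp
  have AE_iff: "(AE p in lebesgue_on ?B. ?h p \<le> c)
      \<longleftrightarrow> (AE p in lborel. p \<in> ?B \<longrightarrow> ennreal (rep p) \<le> c)" for c
  proof -
    have "(AE p in lebesgue_on ?B. ?h p \<le> c) \<longleftrightarrow> (AE p in lborel. p \<in> ?B \<longrightarrow> ?h p \<le> c)"
      using B by (subst AE_restrict_space_iff) (auto simp: AE_completion_iff)
    also have "\<dots> \<longleftrightarrow> (AE p in lborel. p \<in> ?B \<longrightarrow> ennreal (rep p) \<le> c)"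
      using AE_rep sub by (intro eventually_subst) (auto elim!: eventually_mono)
    finally show ?thesis .
  qed
  show ?thesis
    unfolding whitney_avg_def AE_iff[symmetric] if_P[OF r]
    using esssup_I[OF h, of c] esssup_AE[of ?h "lebesgue_on ?B"]
    by (auto elim!: eventually_mono)
qed

text \<open>For finite \<open>r\<close> the average is a quotient of parameter integrals. For
  infinite \<open>r\<close> the sublevel sets are described by the vanishing of a parameter
  integral.\<close>

lemma measurable_whitney_avg:
  assumes r: "0 < r"
  shows "(\<lambda>(t, x). if 0 < t then whitney_avg \<beta> r f t x else 0) \<in> borel_measurable (borel \<Otimes>\<^sub>M borel)"
proof (cases "r = \<infinity>")
  case True
  have [measurable]: "rep \<in> borel_measurable (borel \<Otimes>\<^sub>M borel)" by (simp add: borel_prod)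
  show ?thesis
  proof (rule borel_measurableI_le)
    fix c :: ennreal
    \<comment> \<open>The measure of the part of the box where \<open>rep\<close> exceeds
      \<open>c\<close>; it vanishes exactly when the essential supremum is at most
      \<open>c\<close>.\<close>
    define N :: "real \<times> (real ^ 'n) \<Rightarrow> ennreal" where "N = (\<lambda>(t, x). \<integral>\<^sup>+ p. (if t / 2 < fst p \<and> fst p \<le> t \<and> dist x (snd p) < t
        \<and> c < ennreal (rep p) then 1 else 0) \<partial>(lborel \<Otimes>\<^sub>M lborel))"
    have [measurable]: "N \<in> borel_measurable (borel \<Otimes>\<^sub>M borel)"
      unfolding N_def by measurable
    have "whitney_avg \<beta> r f t x \<le> c \<longleftrightarrow> N (t, x) = 0" if "0 < t" for t x
    proof -
      let ?F = "\<lambda>p. if t / 2 < fst p \<and> fst p \<le> t \<and> dist x (snd p) < t \<and> c < ennreal (rep p)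
        then 1 else 0 :: ennreal"
      have "?F \<in> borel_measurable (lborel \<Otimes>\<^sub>M lborel)" by measurable
      then have "N (t, x) = 0 \<longleftrightarrow> (AE p in lborel \<Otimes>\<^sub>M lborel. ?F p = 0)"
        unfolding N_def prod.case by (rule nn_integral_0_iff_AE)
      also have "\<dots> \<longleftrightarrow> (AE p in lborel. ?F p = 0)"
        by (simp only: lborel_prod)
      also have "(\<lambda>p. ?F p = 0) = (\<lambda>p. p \<in> whitney_box t x \<longrightarrow> ennreal (rep p) \<le> c)"
        by (auto simp: fun_eq_iff not_less)
      finally show ?thesis
        unfolding whitney_avg_infinite_le_iff[OF True that] by simp
    qed
    then have "{p \<in> space (borel \<Otimes>\<^sub>M borel). (case p of (t, x) \<Rightarrow> if 0 < t then whitney_avg \<beta> r f t x else 0) \<le> c}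
       = {p \<in> space (borel \<Otimes>\<^sub>M borel). fst p \<le> 0 \<or> N p = 0}"
      using True by (auto simp: not_less split: if_splits)
    also have "\<dots> \<in> sets (borel \<Otimes>\<^sub>M borel)" by measurable
    finally show "{p \<in> space (borel \<Otimes>\<^sub>M borel). (case p of (t, x) \<Rightarrow> if 0 < t then whitney_avg \<beta> r f t x else 0) \<le> c}
       \<in> sets (borel \<Otimes>\<^sub>M borel)" .
  qed
next
  case False
  have [measurable]: "rep \<in> borel_measurable (borel \<Otimes>\<^sub>M borel)" by (simp add: borel_prod)
  define N :: "real \<times> (real ^ 'n) \<Rightarrow> ennreal" where "N = (\<lambda>(t, x). \<integral>\<^sup>+ p. (if t / 2 < fst p \<and> fst p \<le> t \<and> dist x (snd p) < t
        then ennreal (rep p powr enn2real r) else 0) \<partial>(lborel \<Otimes>\<^sub>M lborel))"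
  have [measurable]: "N \<in> borel_measurable (borel \<Otimes>\<^sub>M borel)"
    unfolding N_def by measurable
  have N: "(\<integral>\<^sup>+ p\<in>whitney_box t x. ennreal (rep p powr enn2real r) \<partial>lborel) = N (t, x)" for t x
    unfolding N_def prod.case lborel_prod
    by (intro nn_integral_cong) (auto simp: indicator_def)
  have vol: "emeasure lborel (whitney_box t x)
      = ennreal (t / 2) * ennreal (unit_ball_vol (real CARD('n)) * t ^ CARD('n))" if "0 < t" for t and x :: "real ^ 'n"
    using that by (simp add: emeasure_whitney_box emeasure_ball)
  have "(\<lambda>(t, x). if 0 < t then whitney_avg \<beta> r f t x else 0)
    = (\<lambda>p. if 0 < fst p then ennpowr (N p / (ennreal (fst p / 2) *
        ennreal (unit_ball_vol (real CARD('n)) * fst p ^ CARD('n)))) (1 / enn2real r) else 0)"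
    using False by (auto simp: fun_eq_iff whitney_avg_finite N vol)
  also have "\<dots> \<in> borel_measurable (borel \<Otimes>\<^sub>M borel)"
    by measurable
  finally show ?thesis .
qed

text \<open>For \<open>r = \<infinity>\<close> only the summand \<open>1\<close> of the constant matters: the exponent \<open>1 / enn2real r\<close> is then the junk
  value \<open>1 / 0 = 0\<close>.\<close>

lemma whitney_avg_le_sum:
  assumes r: "0 < r" and t: "0 < t" and I: "finite I"
    and T: "\<And>i. i \<in> I \<Longrightarrow> 0 < T i \<and> T i \<le> 2 * t"
    and cover: "whitney_box t x \<subseteq> (\<Union>i\<in>I. whitney_box (T i) (X i))"
  shows "whitney_avg \<beta> r f t x \<le> ennreal (1 + (2 ^ (CARD('n) + 1) * real (card I)) powr (1 / enn2real r))
    * (\<Sum>i\<in>I. whitney_avg \<beta> r f (T i) (X i))"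
proof (cases "r = \<infinity>")
  case True
  let ?S = "\<Sum>i\<in>I. whitney_avg \<beta> r f (T i) (X i)"
  have "AE p in lborel. p \<in> whitney_box (T i) (X i) \<longrightarrow> ennreal (rep p) \<le> ?S" if i: "i \<in> I" for i
  proof -
    have "whitney_avg \<beta> r f (T i) (X i) \<le> ?S"
      using I i by (intro member_le_sum) auto
    then show ?thesis using T[OF i] True by (simp add: whitney_avg_infinite_le_iff)
  qed
  then have "AE p in lborel. \<forall>i\<in>I. p \<in> whitney_box (T i) (X i) \<longrightarrow> ennreal (rep p) \<le> ?S"
    using I by (intro AE_finite_allI)
  then have "AE p in lborel. p \<in> whitney_box t x \<longrightarrow> ennreal (rep p) \<le> ?S"
    by (rule eventually_mono) (use cover in blast)
  then have "whitney_avg \<beta> r f t x \<le> ?S"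
    using t True by (simp add: whitney_avg_infinite_le_iff)
  also have "\<dots> = ennreal 1 * ?S" by simp
  also have "\<dots> \<le> ennreal (1 + (2 ^ (CARD('n) + 1) * real (card I)) powr (1 / enn2real r)) * ?S"
    by (intro mult_right_mono ennreal_leI) auto
  finally show ?thesis .
next
  case False
  let ?\<rho> = "enn2real r"
  let ?c = "\<lambda>t x. emeasure lborel (whitney_box t x)"
  let ?N = "\<lambda>t x. \<integral>\<^sup>+ p\<in>whitney_box t x. ennreal (rep p powr ?\<rho>) \<partial>lborel"
  let ?D = "ennreal (2 ^ (CARD('n) + 1))"
  have \<rho>: "0 < ?\<rho>" using r False by (simp add: enn2real_positive_iff less_top)
  have c: "0 < ?c s z" "?c s z < top" if "0 < s" for s z
    using that emeasure_ball_pos_finite[of s z]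
    by (auto simp: emeasure_whitney_box ennreal_zero_less_mult_iff ennreal_mult_less_top)
  have [measurable]: "whitney_box s z \<in> sets borel" for s and z :: "real ^ 'n" by (rule whitney_box_sets)
  have "?N t x \<le> (\<integral>\<^sup>+ p. (\<Sum>i\<in>I. ennreal (rep p powr ?\<rho>) * indicator (whitney_box (T i) (X i)) p) \<partial>lborel)"
  proof (rule nn_integral_mono)
    fix p
    show "ennreal (rep p powr ?\<rho>) * indicator (whitney_box t x) p
        \<le> (\<Sum>i\<in>I. ennreal (rep p powr ?\<rho>) * indicator (whitney_box (T i) (X i)) p)"
    proof (cases "p \<in> whitney_box t x")
      case True
      then obtain i where i: "i \<in> I" "p \<in> whitney_box (T i) (X i)" using cover by blast
      have "ennreal (rep p powr ?\<rho>) * indicator (whitney_box (T i) (X i)) p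
          \<le> (\<Sum>i\<in>I. ennreal (rep p powr ?\<rho>) * indicator (whitney_box (T i) (X i)) p)"
        using i(1) I by (intro member_le_sum) auto
      then show ?thesis using i True by simp
    qed simp
  qed
  also have "\<dots> = (\<Sum>i\<in>I. ?N (T i) (X i))"
    by (rule nn_integral_sum) measurable
  \<comment> \<open>Integrals over the covering boxes become averages: as
    \<open>T i \<le> 2 * t\<close>, the volume of each box is at most \<open>?D\<close> times that
    of the covered one.\<close>
  also have "\<dots> \<le> (\<Sum>i\<in>I. ?N (T i) (X i) / ?c (T i) (X i) * (?D * ?c t x))"
  proof (rule sum_mono)
    fix i assume i: "i \<in> I"
    have "?N (T i) (X i) = ?N (T i) (X i) / ?c (T i) (X i) * ?c (T i) (X i)"
      using c[of "T i" "X i"] T[OF i] by (simp add: ennreal_divide_times ennreal_divide_self)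
    also have "\<dots> \<le> ?N (T i) (X i) / ?c (T i) (X i) * (?D * ?c t x)"
      using T[OF i] emeasure_whitney_box_le[of "T i" t "X i" x] by (intro mult_left_mono) auto
    finally show "?N (T i) (X i) \<le> ?N (T i) (X i) / ?c (T i) (X i) * (?D * ?c t x)" .
  qed
  also have "\<dots> = ?c t x * (?D * (\<Sum>i\<in>I. ?N (T i) (X i) / ?c (T i) (X i)))"
    by (simp only: sum_distrib_left mult_ac)
  finally have "?N t x / ?c t x \<le> ?D * (\<Sum>i\<in>I. ?N (T i) (X i) / ?c (T i) (X i))"
    using c[OF t, of x] by (intro divide_le_posI_ennreal) auto
  then have "ennpowr (?N t x / ?c t x) (1 / ?\<rho>)
      \<le> ennpowr (?D * (\<Sum>i\<in>I. ?N (T i) (X i) / ?c (T i) (X i))) (1 / ?\<rho>)"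
    using \<rho> by (intro ennpowr_mono) auto
  also have "\<dots> = ennreal ((2 ^ (CARD('n) + 1)) powr (1 / ?\<rho>))
      * ennpowr (\<Sum>i\<in>I. ?N (T i) (X i) / ?c (T i) (X i)) (1 / ?\<rho>)"
    using \<rho> by (simp add: ennpowr_mult ennpowr_ennreal del: power_Suc)
  also have "\<dots> \<le> ennreal ((2 ^ (CARD('n) + 1)) powr (1 / ?\<rho>))
      * (ennreal (real (card I) powr (1 / ?\<rho>)) * (\<Sum>i\<in>I. ennpowr (?N (T i) (X i) / ?c (T i) (X i)) (1 / ?\<rho>)))"
    using \<rho> I by (intro mult_left_mono ennpowr_sum_le) auto
  also have "\<dots> = ennreal ((2 ^ (CARD('n) + 1) * real (card I)) powr (1 / ?\<rho>))
      * (\<Sum>i\<in>I. whitney_avg \<beta> r f (T i) (X i))"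
    using False T by (simp add: powr_mult ennreal_mult whitney_avg_finite mult.assoc)
  also have "\<dots> \<le> ennreal (1 + (2 ^ (CARD('n) + 1) * real (card I)) powr (1 / ?\<rho>))
      * (\<Sum>i\<in>I. whitney_avg \<beta> r f (T i) (X i))"
    by (intro mult_right_mono ennreal_leI) auto
  finally show ?thesis
    using t False by (simp add: whitney_avg_finite)
qed

end

section \<open>A finite cover of the unit ball, and essential suprema with parameters\<close>

lemma unit_ball_cover:
  obtains E :: "'a::euclidean_space set"
  where "finite E" "\<And>e. e \<in> E \<Longrightarrow> norm e \<le> 1"
    "\<And>t x v. 0 < t \<Longrightarrow> dist x v < t \<Longrightarrow> \<exists>e\<in>E. dist (x + t *\<^sub>R e) v < t / 2"
proof -
  have "\<exists>E :: 'a set. finite E \<and> E \<subseteq> cball 0 1 \<and> cball 0 1 \<subseteq> (\<Union>e\<in>E. ball e (1 / 2))"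
    by (rule seq_compact_imp_totally_bounded[rule_format]) (auto simp: compact_imp_seq_compact)
  then obtain E :: "'a set"
    where E: "finite E" "E \<subseteq> cball 0 1" "cball 0 1 \<subseteq> (\<Union>e\<in>E. ball e (1 / 2))" by blast
  show thesis
  proof (rule that[OF E(1)])
    show "norm e \<le> 1" if "e \<in> E" for e using E(2) that by auto
    fix t :: real and x v :: 'a
    assume t: "0 < t" and v: "dist x v < t"
    let ?u = "(1 / t) *\<^sub>R (v - x)"
    have "norm ?u \<le> 1" using t v by (simp add: dist_norm norm_minus_commute)
    then have "?u \<in> cball 0 1" by (simp only: mem_cball_0)
    then have "?u \<in> (\<Union>e\<in>E. ball e (1 / 2))" using E(3) by blast
    then obtain e where e: "e \<in> E" "dist e ?u < 1 / 2" by (auto simp only: UN_iff mem_ball)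
    have "x + t *\<^sub>R e - v = t *\<^sub>R (e - ?u)" using t by (simp add: algebra_simps)
    then have "dist (x + t *\<^sub>R e) v = t * dist e ?u" using t by (simp add: dist_norm)
    also have "\<dots> < t * (1 / 2)" using t e(2) by (intro mult_strict_left_mono)
    finally show "\<exists>e\<in>E. dist (x + t *\<^sub>R e) v < t / 2" using e(1) by auto
  qed
qed

text \<open>The sublevel sets in \<open>x\<close> are zero sets of a measurable parameter integral,
  as for Whitney averages with \<open>r = \<infinity>\<close>.\<close>

lemma measurable_esssup:
  fixes u :: "real \<Rightarrow> 'a::euclidean_space \<Rightarrow> ennreal"
  assumes [measurable]: "(\<lambda>(t, x). u t x) \<in> borel_measurable (borel \<Otimes>\<^sub>M borel)"
  shows "(\<lambda>x. esssup (lebesgue_on {0<..<\<tau>}) (\<lambda>t. u t x)) \<in> borel_measurable borel"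
proof (rule borel_measurableI_le)
  fix c
  have sec: "(\<lambda>t. u t x) \<in> borel_measurable borel" for x by measurable
  have "(\<lambda>t. u t x) \<in> borel_measurable (lebesgue_on {0<..<\<tau>})" for x
    by (intro measurable_restrict_space1 measurable_completion) (simp add: sec)
  then have "esssup (lebesgue_on {0<..<\<tau>}) (\<lambda>t. u t x) \<le> c
      \<longleftrightarrow> (AE t in lebesgue_on {0<..<\<tau>}. u t x \<le> c)" for x
    using esssup_I[of "\<lambda>t. u t x" _ c] esssup_AE[of "\<lambda>t. u t x" "lebesgue_on {0<..<\<tau>}"]
    by (auto elim!: eventually_mono)
  also have "(AE t in lebesgue_on {0<..<\<tau>}. u t x \<le> c)
      \<longleftrightarrow> (AE t in lborel. t \<in> {0<..<\<tau>} \<longrightarrow> u t x \<le> c)" for x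
    by (subst AE_restrict_space_iff) (auto simp: AE_completion_iff)
  also have "(AE t in lborel. t \<in> {0<..<\<tau>} \<longrightarrow> u t x \<le> c)
      \<longleftrightarrow> (AE t in lborel. (if t \<in> {0<..<\<tau>} \<and> c < u t x then 1 else 0 :: ennreal) = 0)" for x
    by (auto simp: not_less)
  also have "(AE t in lborel. (if t \<in> {0<..<\<tau>} \<and> c < u t x then 1 else 0 :: ennreal) = 0)
      \<longleftrightarrow> (\<integral>\<^sup>+ t. (if t \<in> {0<..<\<tau>} \<and> c < u t x then 1 else 0) \<partial>lborel) = 0" for x
    by (rule nn_integral_0_iff_AE[symmetric]) measurable
  finally have "{x \<in> space borel. esssup (lebesgue_on {0<..<\<tau>}) (\<lambda>t. u t x) \<le> c}
    = {x \<in> space borel. (\<integral>\<^sup>+ t. (if t \<in> {0<..<\<tau>} \<and> c < u t x then 1 else 0) \<partial>lborel) = 0}"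
    by simp
  also have "\<dots> \<in> sets borel" by measurable
  finally show "{x \<in> space borel. esssup (lebesgue_on {0<..<\<tau>}) (\<lambda>t. u t x) \<le> c} \<in> sets borel" .
qed

context half_space_fun
begin

text \<open>The value 0 at nonpositive heights gives joint measurability on the whole
  product.\<close>

definition whitney_pow :: "ennreal \<Rightarrow> real \<Rightarrow> real \<Rightarrow> real ^ 'n \<Rightarrow> ennreal" where
  "whitney_pow r a t x = (if 0 < t then ennpowr (whitney_avg \<beta> r f t x) a else 0)"

lemma measurable_whitney_pow:
  assumes "0 < r"
  shows "(\<lambda>(t, x). whitney_pow r a t x) \<in> borel_measurable (borel \<Otimes>\<^sub>M borel)"
proof -
  have "(\<lambda>(t, x). whitney_pow r a t x)
      = (\<lambda>p. ennpowr ((\<lambda>(t, x). if 0 < t then whitney_avg \<beta> r f t x else 0) p) a)"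
    by (auto simp: whitney_pow_def fun_eq_iff)
  also have "\<dots> \<in> borel_measurable (borel \<Otimes>\<^sub>M borel)"
    by (intro borel_measurable_ennpowr measurable_whitney_avg assms)
  finally show ?thesis .
qed

text \<open>The heights \<open>T i\<close> may differ from \<open>t\<close> because the case
  \<open>q = \<infinity>\<close> covers a box by boxes of two nearby heights.\<close>

lemma whitney_pow_le_sum:
  assumes r: "0 < r" and a: "0 < a" and t: "0 < t" and I: "finite I"
    and T: "\<And>i. i \<in> I \<Longrightarrow> 0 < T i \<and> T i \<le> 2 * t"
    and cover: "whitney_box t x \<subseteq> (\<Union>i\<in>I. whitney_box (T i) (X i))"
  shows "whitney_pow r a t x
    \<le> ennreal (((1 + (2 ^ (CARD('n) + 1) * real (card I)) powr (1 / enn2real r)) * real (card I)) powr a)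
    * (\<Sum>i\<in>I. whitney_pow r a (T i) (X i))"
proof -
  let ?C = "1 + (2 ^ (CARD('n) + 1) * real (card I)) powr (1 / enn2real r)"
  let ?W = "\<lambda>i. whitney_avg \<beta> r f (T i) (X i)"
  have C: "0 \<le> ?C" by (simp add: add_nonneg_nonneg)
  have "whitney_avg \<beta> r f t x \<le> ennreal ?C * (\<Sum>i\<in>I. ?W i)"
    by (rule whitney_avg_le_sum[OF r t I T cover])
  then have "ennpowr (whitney_avg \<beta> r f t x) a \<le> ennpowr (ennreal ?C * (\<Sum>i\<in>I. ?W i)) a"
    by (rule ennpowr_mono) fact
  also have "\<dots> = ennreal (?C powr a) * ennpowr (\<Sum>i\<in>I. ?W i) a"
    using a C by (simp only: ennpowr_mult ennpowr_ennreal)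
  also have "\<dots> \<le> ennreal (?C powr a) * (ennreal (real (card I) powr a) * (\<Sum>i\<in>I. ennpowr (?W i) a))"
    by (intro mult_left_mono ennpowr_sum_le I a) simp
  also have "\<dots> = ennreal ((?C * real (card I)) powr a) * (\<Sum>i\<in>I. ennpowr (?W i) a)"
    using C by (subst powr_mult) (auto simp: ennreal_mult mult.assoc)
  also have "(\<Sum>i\<in>I. ennpowr (?W i) a) = (\<Sum>i\<in>I. whitney_pow r a (T i) (X i))"
    using T by (intro sum.cong) (auto simp: whitney_pow_def)
  finally show ?thesis using t by (simp add: whitney_pow_def)
qed

text \<open>Passing from centre \<open>x\<close> to \<open>z\<close> costs less than
  \<open>t / 2\<close>, and the cover of \<open>ball x t\<close> by balls of radius
  \<open>t / 2\<close> leaves exactly that much room. Boxes of the same height therefore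
  suffice.\<close>

lemma quasi_constant_whitney_pow:
  fixes E :: "(real ^ 'n) set"
  assumes r: "0 < r" and a: "0 < a" and E: "finite E" "\<And>e. e \<in> E \<Longrightarrow> norm e \<le> 1"
    and cover: "\<And>t (x :: real ^ 'n) v. 0 < t \<Longrightarrow> dist x v < t \<Longrightarrow> \<exists>e\<in>E. dist (x + t *\<^sub>R e) v < t / 2"
  shows "quasi_constant (whitney_pow r a) E
    (((1 + (2 ^ (CARD('n) + 1) * real (card E)) powr (1 / enn2real r)) * real (card E)) powr a)"
proof
  fix t :: real and x z :: "real ^ 'n"
  assume t: "0 < t" and xz: "dist x z < t / 2"
  have "whitney_box t x \<subseteq> (\<Union>e\<in>E. whitney_box t (z + t *\<^sub>R e))"
  proof (clarsimp simp del: mem_ball)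
    fix s v assume "v \<in> ball x t" and s: "t < s * 2" "s \<le> t"
    then obtain e where e: "e \<in> E" "dist (x + t *\<^sub>R e) v < t / 2" using cover[OF t, of x v] by auto
    have "dist (z + t *\<^sub>R e) v \<le> dist (z + t *\<^sub>R e) (x + t *\<^sub>R e) + dist (x + t *\<^sub>R e) v"
      by (rule dist_triangle)
    also have "\<dots> < t" using e xz by (simp add: dist_commute)
    finally show "\<exists>e\<in>E. v \<in> ball (z + t *\<^sub>R e) t" using e by auto
  qed
  then show "whitney_pow r a t x
    \<le> ennreal (((1 + (2 ^ (CARD('n) + 1) * real (card E)) powr (1 / enn2real r)) * real (card E)) powr a)
      * (\<Sum>e\<in>E. whitney_pow r a t (z + t *\<^sub>R e))"
    using t by (intro whitney_pow_le_sum r a E(1)) auto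
qed (use assms measurable_whitney_pow in auto)

lemma tent_norm_eq_moment:
  assumes q: "0 < q" "q \<noteq> \<infinity>" and qc: "quasi_constant (whitney_pow r (enn2real q)) E K"
  shows "tent_norm q r \<beta> f
    = ennpowr (quasi_constant.moment (whitney_pow r (enn2real q)) 1) (1 / enn2real q)"
proof -
  interpret quasi_constant "whitney_pow r (enn2real q)" E K by (rule qc)
  have q': "0 < enn2real q" using q by (simp add: enn2real_positive_iff less_top)
  have "(\<integral>\<^sup>+ t\<in>{0<..<\<tau>}. (mean_integral (ball y \<tau>)
          (\<lambda>x. ennpowr (whitney_avg \<beta> r f t x) (enn2real q)) / ennreal t) \<partial>lebesgue)
      = mean_integral (ball y \<tau>) (\<lambda>x. ennpowr (sq_fun \<tau> x) 1)" for \<tau> y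
    unfolding nn_integral_completion ennpowr_1 mean_integral_sq_fun
    by (intro nn_integral_cong) (auto simp: indicator_def whitney_pow_def[abs_def])
  then show ?thesis
    using q' q by (simp add: tent_norm_def moment_def ennpowr_SUP)
qed

lemma vertical_norm_eq_moment:
  assumes q: "0 < q" "q \<noteq> \<infinity>" and \<alpha>: "0 < \<alpha>" and qc: "quasi_constant (whitney_pow r (enn2real q)) E K"
  shows "vertical_norm q r \<alpha> \<beta> f
    = ennpowr (quasi_constant.moment (whitney_pow r (enn2real q)) (\<alpha> / enn2real q)) (1 / \<alpha>)"
proof -
  interpret quasi_constant "whitney_pow r (enn2real q)" E K by (rule qc)
  have "(\<integral>\<^sup>+ t\<in>{0<..<\<tau>}. (ennpowr (whitney_avg \<beta> r f t x) (enn2real q) / ennreal t) \<partial>lebesgue)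
      = sq_fun \<tau> x" for \<tau> x
    unfolding nn_integral_completion sq_fun_def
    by (intro nn_integral_cong) (auto simp: indicator_def whitney_pow_def)
  then show ?thesis
    using \<alpha> q by (simp add: vertical_norm_def moment_def ennpowr_SUP)
qed

end

section \<open>The case \<open>q = \<infinity>\<close>\<close>

lemma AE_lborel_interval_ex:
  assumes "AE s in lborel. P s" "a < (b :: real)"
  shows "\<exists>s. a < s \<and> s < b \<and> P s"
proof (rule ccontr)
  assume "\<not> ?thesis"
  then have "AE s in lborel. s \<notin> {a<..<b}"
    using assms(1) by (auto elim!: eventually_mono)
  then have "emeasure lborel {a<..<b} = 0"
    by (subst (asm) AE_iff_measurable[of "{a<..<b}"]) auto
  then show False using assms(2) by simp
qed

context half_space_fun
begin

lemma measurable_whitney_avg_section: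
  assumes "0 < r"
  shows "(\<lambda>t. whitney_avg \<beta> r f t x) \<in> borel_measurable (lebesgue_on {0<..<\<tau>})"
proof -
  have [measurable]: "(\<lambda>(t, x). whitney_pow r 1 t x) \<in> borel_measurable (borel \<Otimes>\<^sub>M borel)"
    using assms by (rule measurable_whitney_pow)
  have "(\<lambda>t. whitney_pow r 1 t x) \<in> borel_measurable borel" by measurable
  then have "(\<lambda>t. whitney_pow r 1 t x) \<in> borel_measurable (lebesgue_on {0<..<\<tau>})"
    by (intro measurable_restrict_space1 measurable_completion) simp
  then show ?thesis
    by (subst measurable_cong[where g = "\<lambda>t. whitney_pow r 1 t x"]) (auto simp: whitney_pow_def)
qed

lemma measurable_maximal_whitney_avg:
  assumes "0 < r"
  shows "(\<lambda>x. esssup (lebesgue_on {0<..<\<tau>}) (\<lambda>t. whitney_avg \<beta> r f t x)) \<in> borel_measurable borel"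
proof -
  have eq: "esssup (lebesgue_on {0<..<\<tau>}) (\<lambda>t. whitney_avg \<beta> r f t x)
      = esssup (lebesgue_on {0<..<\<tau>}) (\<lambda>t. whitney_pow r 1 t x)" for x
  proof (rule esssup_AE_cong)
    show "(\<lambda>t. whitney_pow r 1 t x) \<in> borel_measurable (lebesgue_on {0<..<\<tau>})"
      using measurable_whitney_avg_section[OF assms, of x \<tau>]
      by (subst measurable_cong[where g = "\<lambda>t. whitney_avg \<beta> r f t x"]) (auto simp: whitney_pow_def)
  qed (use measurable_whitney_avg_section[OF assms] in \<open>auto simp: whitney_pow_def intro!: AE_I2\<close>)
  show ?thesis
    unfolding eq by (rule measurable_esssup) (rule measurable_whitney_pow[OF assms])
qed

text \<open>Here the tent norm bounds every single Whitney average, and averaging a constant does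
  not increase it.\<close>

lemma vertical_norm_top_le:
  assumes r: "0 < r" and \<alpha>: "0 < \<alpha>"
  shows "vertical_norm \<infinity> r \<alpha> \<beta> f \<le> tent_norm \<infinity> r \<beta> f"
proof -
  let ?T = "tent_norm \<infinity> r \<beta> f"
  have W: "whitney_avg \<beta> r f t x \<le> ?T" if "0 < t" for t x
    using that unfolding tent_norm_def by (auto intro!: SUP_upper2[of t] SUP_upper2[of x])
  have A: "esssup (lebesgue_on {0<..<\<tau>}) (\<lambda>t. whitney_avg \<beta> r f t x) \<le> ?T" for \<tau> x
    by (rule esssup_I[OF measurable_whitney_avg_section[OF r]], rule AE_I2, rule W) simp
  have "ennpowr (mean_integral (ball y \<tau>)
      (\<lambda>x. ennpowr (esssup (lebesgue_on {0<..<\<tau>}) (\<lambda>t. whitney_avg \<beta> r f t x)) \<alpha>)) (1 / \<alpha>) \<le> ?T"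
    if \<tau>: "0 < \<tau>" for \<tau> y
  proof -
    have "mean_integral (ball y \<tau>)
        (\<lambda>x. ennpowr (esssup (lebesgue_on {0<..<\<tau>}) (\<lambda>t. whitney_avg \<beta> r f t x)) \<alpha>)
        \<le> mean_integral (ball y \<tau>) (\<lambda>x. ennpowr ?T \<alpha>)"
      by (intro mean_integral_mono ennpowr_mono A \<alpha>)
    also have "\<dots> \<le> ennpowr ?T \<alpha>" by (rule mean_integral_const_le[OF \<tau>])
    finally show ?thesis using \<alpha> by (simp add: ennpowr_le_iff)
  qed
  then show ?thesis
    unfolding vertical_norm_def by (auto intro!: SUP_least)
qed

text \<open>Every height must be bounded although the vertical norm sees only almost every height.
  The box at \<open>t\<close> is therefore covered by boxes at admissible heights near
  \<open>t\<close>, with centres depending on \<open>z\<close>, and the estimate is averaged over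
  \<open>z\<close> near \<open>x\<close>.\<close>

lemma tent_norm_top_le:
  fixes E :: "(real ^ 'n) set"
  assumes r: "0 < r" and \<alpha>: "0 < \<alpha>" and E: "finite E" "\<And>e. e \<in> E \<Longrightarrow> norm e \<le> 1"
    and cover: "\<And>t (x :: real ^ 'n) v. 0 < t \<Longrightarrow> dist x v < t \<Longrightarrow> \<exists>e\<in>E. dist (x + t *\<^sub>R e) v < t / 2"
  defines "C \<equiv> ((1 + (2 ^ (CARD('n) + 1) * real (2 * card E)) powr (1 / enn2real r)) * real (2 * card E)) powr \<alpha>"
  shows "tent_norm \<infinity> r \<beta> f
    \<le> ennreal ((C * 2 * real (card E) * 8 ^ CARD('n)) powr (1 / \<alpha>)) * vertical_norm \<infinity> r \<alpha> \<beta> f"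
proof -
  let ?V = "vertical_norm \<infinity> r \<alpha> \<beta> f"
  define A where "A t x = ennpowr (esssup (lebesgue_on {0<..<t}) (\<lambda>s. whitney_avg \<beta> r f s x)) \<alpha>" for t x
  have [measurable]: "A t \<in> borel_measurable borel" for t
    unfolding A_def by (intro borel_measurable_ennpowr measurable_maximal_whitney_avg r)
  have V: "mean_integral (ball y \<tau>) (A \<tau>) \<le> ennpowr ?V \<alpha>" if "0 < \<tau>" for y \<tau>
  proof -
    have "ennpowr (mean_integral (ball y \<tau>) (A \<tau>)) (1 / \<alpha>) \<le> ?V"
      using that unfolding vertical_norm_def A_def
      by (auto intro!: SUP_upper2[of \<tau>] SUP_upper2[of y])
    then show ?thesis using \<alpha> by (simp add: ennpowr_le_iff)
  qed
  have AE_A: "AE s in lborel. s \<in> {0<..<\<tau>} \<longrightarrow> whitney_pow r \<alpha> s x \<le> A \<tau> x" for \<tau> x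
  proof -
    have "AE s in lebesgue_on {0<..<\<tau>}.
        whitney_avg \<beta> r f s x \<le> esssup (lebesgue_on {0<..<\<tau>}) (\<lambda>s. whitney_avg \<beta> r f s x)"
      by (rule esssup_AE)
    then have "AE s in lborel. s \<in> {0<..<\<tau>} \<longrightarrow>
        whitney_avg \<beta> r f s x \<le> esssup (lebesgue_on {0<..<\<tau>}) (\<lambda>s. whitney_avg \<beta> r f s x)"
      by (subst (asm) AE_restrict_space_iff) (auto simp: AE_completion_iff)
    then show ?thesis
      by (rule eventually_mono) (auto simp: whitney_pow_def A_def intro!: ennpowr_mono \<alpha>)
  qed
  have "whitney_avg \<beta> r f t x \<le> ennreal ((C * 2 * real (card E) * 8 ^ CARD('n)) powr (1 / \<alpha>)) * ?V"
    if t: "0 < t" for t x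
  proof -
    have pointwise: "whitney_pow r \<alpha> t x \<le> ennreal (C * 2) * (\<Sum>e\<in>E. A (2 * t) (z + t *\<^sub>R e))"
      if z: "dist x z < t / 4" for z
    proof -
      have ae: "AE s in lborel. \<forall>e\<in>E. s \<in> {0<..<2 * t} \<longrightarrow>
          whitney_pow r \<alpha> s (z + t *\<^sub>R e) \<le> A (2 * t) (z + t *\<^sub>R e)"
        by (intro AE_finite_allI E(1) AE_A)
      \<comment> \<open>Radii above \<open>3 * t / 4\<close> suffice because
        \<open>t / 4 + t / 2 = 3 * t / 4\<close>. The bounds \<open>s' / 2 < 3 * t / 4 < s\<close>
        leave no gap between the two height intervals.\<close>
      obtain s where s: "3 * t / 4 < s" "s < t"
        and s_le: "\<And>e. e \<in> E \<Longrightarrow> whitney_pow r \<alpha> s (z + t *\<^sub>R e) \<le> A (2 * t) (z + t *\<^sub>R e)"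
        using AE_lborel_interval_ex[OF ae, of "3 * t / 4" t] t by auto
      obtain s' where s': "t < s'" "s' < 3 * t / 2"
        and s'_le: "\<And>e. e \<in> E \<Longrightarrow> whitney_pow r \<alpha> s' (z + t *\<^sub>R e) \<le> A (2 * t) (z + t *\<^sub>R e)"
        using AE_lborel_interval_ex[OF ae, of t "3 * t / 2"] t by auto
      \<comment> \<open>Boxes at the two heights \<open>s < t < s'\<close> are needed, because only almost every height is admissible and no
        box of height other than \<open>t\<close> has a time interval containing \<open>{t / 2<..t}\<close>.\<close>
      let ?I = "E \<times> {s, s'}"
      have "s \<noteq> s'" using s s' by simp
      then have card_I: "card ?I = 2 * card E" by (simp add: card_cartesian_product)
      have "whitney_box t x \<subseteq> (\<Union>i\<in>?I. whitney_box (snd i) (z + t *\<^sub>R fst i))"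
      proof
        fix p assume p: "p \<in> whitney_box t x"
        then obtain e where e: "e \<in> E" "dist (x + t *\<^sub>R e) (snd p) < t / 2"
          using cover[OF t, of x "snd p"] by auto
        have "dist (z + t *\<^sub>R e) (snd p) \<le> dist (z + t *\<^sub>R e) (x + t *\<^sub>R e) + dist (x + t *\<^sub>R e) (snd p)"
          by (rule dist_triangle)
        also have "\<dots> < 3 * t / 4" using e z by (simp add: dist_commute)
        finally have d: "dist (z + t *\<^sub>R e) (snd p) < 3 * t / 4" .
        show "p \<in> (\<Union>i\<in>?I. whitney_box (snd i) (z + t *\<^sub>R fst i))"
        proof (cases "fst p \<le> s")
          case True
          then have "p \<in> whitney_box s (z + t *\<^sub>R e)"
            using p d s by (auto simp: mem_Times_iff)
          then show ?thesis using e by (intro UN_I[of "(e, s)"]) auto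
        next
          case False
          then have "p \<in> whitney_box s' (z + t *\<^sub>R e)"
            using p d s s' by (auto simp: mem_Times_iff)
          then show ?thesis using e by (intro UN_I[of "(e, s')"]) auto
        qed
      qed
      then have "whitney_pow r \<alpha> t x \<le> ennreal C * (\<Sum>i\<in>?I. whitney_pow r \<alpha> (snd i) (z + t *\<^sub>R fst i))"
        using s s' t E(1) unfolding C_def card_I[symmetric]
        by (intro whitney_pow_le_sum r \<alpha>) auto
      also have "\<dots> \<le> ennreal C * (\<Sum>i\<in>?I. A (2 * t) (z + t *\<^sub>R fst i))"
        by (intro mult_left_mono sum_mono) (auto intro: s_le s'_le)
      also have "(\<Sum>i\<in>?I. A (2 * t) (z + t *\<^sub>R fst i))
          = (\<Sum>e\<in>E. \<Sum>k\<in>{s, s'}. A (2 * t) (z + t *\<^sub>R e))"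
        by (simp only: sum.cartesian_product split_def)
      also have "\<dots> = 2 * (\<Sum>e\<in>E. A (2 * t) (z + t *\<^sub>R e))"
        using \<open>s \<noteq> s'\<close> by (simp add: sum_distrib_left flip: mult_2)
      finally show ?thesis by (simp add: ennreal_mult C_def mult.assoc)
    qed
    let ?b = "emeasure lborel (ball x (t / 4))"
    \<comment> \<open>\<open>A (2 * t)\<close> has to be averaged over a ball of radius
      \<open>2 * t\<close>, eight times \<open>t / 4\<close>; this ball contains all translates of
      \<open>ball x (t / 4)\<close> by \<open>t *\<^sub>R e\<close>.\<close>
    have b8: "emeasure lborel (ball x (2 * t)) = ennreal (8 ^ CARD('n)) * ?b"
      using emeasure_ball_scale[of 8 "t / 4" x x] t by simp
    have shift: "(\<integral>\<^sup>+ z. A (2 * t) (z + t *\<^sub>R e) * indicator (ball x (t / 4)) z \<partial>lborel)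
        \<le> ennpowr ?V \<alpha> * (ennreal (8 ^ CARD('n)) * ?b)" if e: "e \<in> E" for e
    proof -
      have "dist x (z + t *\<^sub>R e) < 2 * t" if "dist x z < t / 4" for z
      proof -
        have "dist z (z + t *\<^sub>R e) \<le> t"
          using E(2)[OF e] t by (simp add: dist_norm mult_left_le)
        then show ?thesis using that t dist_triangle[of x "z + t *\<^sub>R e" z] by simp
      qed
      then have "(\<integral>\<^sup>+ z. A (2 * t) (z + t *\<^sub>R e) * indicator (ball x (t / 4)) z \<partial>lborel)
          \<le> (\<integral>\<^sup>+ z. A (2 * t) (z + t *\<^sub>R e) * indicator (ball x (2 * t)) (z + t *\<^sub>R e) \<partial>lborel)"
        by (intro nn_integral_mono) (auto simp: indicator_def)
      also have "\<dots> = (\<integral>\<^sup>+ z\<in>ball x (2 * t). A (2 * t) z \<partial>lborel)"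
        by (rule nn_integral_lborel_translation[of "\<lambda>z. A (2 * t) z * indicator (ball x (2 * t)) z"]) measurable
      also have "\<dots> \<le> ennpowr ?V \<alpha> * emeasure lborel (ball x (2 * t))"
        using V[of "2 * t" x] t by (simp add: mean_integral_ball_le_iff)
      finally show ?thesis by (simp add: b8)
    qed
    have "whitney_pow r \<alpha> t x * ?b = (\<integral>\<^sup>+ z\<in>ball x (t / 4). whitney_pow r \<alpha> t x \<partial>lborel)"
      by (simp add: nn_integral_cmult_indicator)
    also have "\<dots> \<le> (\<integral>\<^sup>+ z. ennreal (C * 2) *
        (\<Sum>e\<in>E. A (2 * t) (z + t *\<^sub>R e) * indicator (ball x (t / 4)) z) \<partial>lborel)"
      by (intro nn_integral_mono) (auto simp: indicator_def pointwise)
    also have "\<dots> = ennreal (C * 2) *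
        (\<Sum>e\<in>E. \<integral>\<^sup>+ z. A (2 * t) (z + t *\<^sub>R e) * indicator (ball x (t / 4)) z \<partial>lborel)"
      by (subst nn_integral_cmult, measurable, subst nn_integral_sum, measurable)
    also have "\<dots> \<le> ennreal (C * 2) * (\<Sum>e\<in>E. ennpowr ?V \<alpha> * (ennreal (8 ^ CARD('n)) * ?b))"
      by (intro mult_left_mono sum_mono shift) simp_all
    also have "\<dots> = ennreal (C * 2 * real (card E) * 8 ^ CARD('n)) * ennpowr ?V \<alpha> * ?b"
      by (simp add: ennreal_mult ennreal_of_nat_eq_real_of_nat C_def mult_ac)
    finally have "?b * whitney_pow r \<alpha> t x
        \<le> ?b * (ennreal (C * 2 * real (card E) * 8 ^ CARD('n)) * ennpowr ?V \<alpha>)"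
      by (simp only: mult_ac)
    then have "ennpowr (whitney_avg \<beta> r f t x) \<alpha>
        \<le> ennreal (C * 2 * real (card E) * 8 ^ CARD('n)) * ennpowr ?V \<alpha>"
      using emeasure_ball_pos_finite[of "t / 4" x] t
      by (subst (asm) ennreal_mult_le_mult_iff) (auto simp: whitney_pow_def)
    then have "whitney_avg \<beta> r f t x
        \<le> ennpowr (ennreal (C * 2 * real (card E) * 8 ^ CARD('n)) * ennpowr ?V \<alpha>) (1 / \<alpha>)"
      using \<alpha> by (simp only: ennpowr_le_iff)
    then show ?thesis
      using \<alpha> by (simp add: ennpowr_mult ennpowr_ennpowr ennpowr_ennreal C_def)
  qed
  then show ?thesis
    unfolding tent_norm_def by (auto intro!: SUP_least)
qed

end

text \<open>The cover \<open>E\<close> is fixed before \<open>f\<close>, and all constants are built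
  from it and the exponents. The sum \<open>a + b + 1\<close> is positive and serves both
  directions.\<close>

theorem proposition3p18:
  fixes q r :: ennreal and \<alpha> \<beta> :: real
  assumes "0 < q" and "0 < r" and "0 < \<alpha>"
  shows "\<exists>C::real. 0 < C \<and>
    (\<forall>f \<in> (tent_space q r \<beta> :: (real \<times> (real ^ 'n::finite) \<Rightarrow> complex) set).
       tent_norm q r \<beta> f \<le> ennreal C * vertical_norm q r \<alpha> \<beta> f \<and>
       vertical_norm q r \<alpha> \<beta> f \<le> ennreal C * tent_norm q r \<beta> f)"
proof -
  obtain E :: "(real ^ 'n) set" where E: "finite E" "\<And>e. e \<in> E \<Longrightarrow> norm e \<le> 1"
    and cover: "\<And>t x v. 0 < t \<Longrightarrow> dist x v < t \<Longrightarrow> \<exists>e\<in>E. dist (x + t *\<^sub>R e) v < t / 2"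
    using unit_ball_cover by blast
  have weaken: "x \<le> ennreal (a + b + 1) * y" if "x \<le> ennreal a * y" "0 \<le> b" for a b x y
    using that(1) by (rule order_trans) (use that in \<open>auto intro!: mult_right_mono ennreal_leI\<close>)
  have weaken': "x \<le> ennreal (a + b + 1) * y" if "x \<le> ennreal b * y" "0 \<le> a" for a b x y
    using that(1) by (rule order_trans) (use that in \<open>auto intro!: mult_right_mono ennreal_leI\<close>)
  have half_space: "half_space_fun f" if "f \<in> tent_space q r \<beta>" for f :: "real \<times> (real ^ 'n) \<Rightarrow> complex"
    using that by unfold_locales (simp add: tent_space_def)
  have "\<exists>a b. 0 \<le> a \<and> 0 \<le> b \<and>
    (\<forall>f \<in> (tent_space q r \<beta> :: (real \<times> (real ^ 'n) \<Rightarrow> complex) set).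
       tent_norm q r \<beta> f \<le> ennreal a * vertical_norm q r \<alpha> \<beta> f \<and>
       vertical_norm q r \<alpha> \<beta> f \<le> ennreal b * tent_norm q r \<beta> f)"
  proof (cases "q = \<infinity>")
    case True
    have "vertical_norm q r \<alpha> \<beta> f \<le> ennreal 1 * tent_norm q r \<beta> f"
      if "f \<in> tent_space q r \<beta>" for f :: "real \<times> (real ^ 'n) \<Rightarrow> complex"
      using half_space_fun.vertical_norm_top_le[OF half_space[OF that] assms(2,3)] True by simp
    moreover note half_space_fun.tent_norm_top_le[OF half_space assms(2,3) E cover, folded True]
    ultimately show ?thesis by (meson powr_ge_zero zero_le_one)
  next
    case False
    let ?q = "enn2real q"
    let ?p = "\<alpha> / ?q"
    have q: "0 < ?q" using assms False by (simp add: enn2real_positive_iff less_top)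
    then have p: "0 < ?p" using assms by simp
    define K where "K = ((1 + (2 ^ (CARD('n) + 1) * real (card E)) powr (1 / enn2real r)) * real (card E)) powr ?q"
    \<comment> \<open>\<open>growth\<close> depends on \<open>E\<close> and \<open>K\<close> only,
      so both constants can be named before \<open>f\<close> is given.\<close>
    let ?a = "2 + (2 * (2 * quasi_constant.growth E K 2) powr (1 - ?p)) powr (1 / ?p)"
    let ?b = "(1 + quasi_constant.growth E K (nat \<lceil>?p\<rceil>)) powr (1 / ?p)"
    have "tent_norm q r \<beta> f \<le> ennreal (?a powr (1 / ?q)) * vertical_norm q r \<alpha> \<beta> f \<and>
       vertical_norm q r \<alpha> \<beta> f \<le> ennreal (?b powr (1 / ?q)) * tent_norm q r \<beta> f"
      if f: "f \<in> tent_space q r \<beta>" for f :: "real \<times> (real ^ 'n) \<Rightarrow> complex"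
    proof -
      interpret half_space_fun f \<beta> by (rule half_space[OF f])
      have qc: "quasi_constant (whitney_pow r ?q) E K"
        unfolding K_def by (rule quasi_constant_whitney_pow[OF assms(2) q E cover])
      interpret quasi_constant "whitney_pow r ?q" E K by (rule qc)
      have tent: "tent_norm q r \<beta> f = ennpowr (moment 1) (1 / ?q)"
        by (rule tent_norm_eq_moment[OF assms(1) False qc])
      have vertical: "vertical_norm q r \<alpha> \<beta> f = ennpowr (moment ?p) (1 / \<alpha>)"
        by (rule vertical_norm_eq_moment[OF assms(1) False assms(3) qc])
      have "ennpowr (moment 1) (1 / ?q) < \<infinity>"
        using f by (simp add: tent_space_def flip: tent)
      then have "moment 1 < \<infinity>"
        by (cases "moment 1 = top") (auto simp: less_top)
      then have "moment 1 \<le> ennreal ?a * ennpowr (moment ?p) (1 / ?p)"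
        by (rule moment_1_le[OF p])
      then have "ennpowr (moment 1) (1 / ?q) \<le> ennpowr (ennreal ?a * ennpowr (moment ?p) (1 / ?p)) (1 / ?q)"
        using q by (intro ennpowr_mono) simp_all
      also have "\<dots> = ennpowr (ennreal ?a) (1 / ?q) * ennpowr (ennpowr (moment ?p) (1 / ?p)) (1 / ?q)"
        using q by (intro ennpowr_mult) simp
      also have "ennpowr (ennreal ?a) (1 / ?q) = ennreal (?a powr (1 / ?q))"
        by (intro ennpowr_ennreal add_nonneg_nonneg powr_ge_zero) simp
      also have "ennpowr (ennpowr (moment ?p) (1 / ?p)) (1 / ?q) = ennpowr (moment ?p) (1 / \<alpha>)"
        using q by (simp add: ennpowr_ennpowr)
      finally have "tent_norm q r \<beta> f \<le> ennreal (?a powr (1 / ?q)) * vertical_norm q r \<alpha> \<beta> f"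
        unfolding tent vertical .
      moreover have "ennpowr (moment ?p) (1 / \<alpha>) \<le> ennpowr (ennpowr (ennreal ?b * moment 1) ?p) (1 / \<alpha>)"
        using assms by (intro ennpowr_mono moment_le_moment_1 p) auto
      then have "vertical_norm q r \<alpha> \<beta> f \<le> ennreal (?b powr (1 / ?q)) * tent_norm q r \<beta> f"
        unfolding tent vertical using q assms(3) growth_pos[of "nat \<lceil>?p\<rceil>"]
        by (simp add: ennpowr_mult ennpowr_ennpowr ennpowr_ennreal powr_powr del: ennreal_plus)
      ultimately show ?thesis ..
    qed
    then show ?thesis by (meson powr_ge_zero)
  qed
  then obtain a b where "0 \<le> a" "0 \<le> b" "\<forall>f \<in> (tent_space q r \<beta> :: (real \<times> (real ^ 'n) \<Rightarrow> complex) set).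
       tent_norm q r \<beta> f \<le> ennreal a * vertical_norm q r \<alpha> \<beta> f \<and>
       vertical_norm q r \<alpha> \<beta> f \<le> ennreal b * tent_norm q r \<beta> f"
    by blast
  then show ?thesis
    by (intro exI[of _ "a + b + 1"]) (auto simp del: ennreal_plus intro: weaken weaken')
qed

end
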